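(* For each $n$, let $G_0\sim\mathrm{SBM}(K_n,\Lambda_n=[\Lambda_{i,j;n}],\tau_n)$ on $n$ vertices with communities $B_1,\dots,B_{K_n}$ of sizes $n_1,\dots,n_{K_n}$, labelled (without loss of generality) so that $n_1=\min_i n_i$. Assume there exist constants $b_1,b_2,b_3,b_4>0$ and $0<a_1<a_2<1$ such that $$n_1=b_1n^{a_1};\qquad n^*:=\max_i n_i=b_2 n;\qquad \Lambda_{1,j;n}\le b_3\frac{n^{a_2}}{n_jn_1}\ \text{ for all } j\ne1;\qquad K_n=b_4;$$ $$\Lambda_{i,j;n}\ge 5\frac{\log n}{n_in_j}\ \text{ for all } i\ne j;\qquad \Lambda_{i,i;n}\ge 5\frac{\log n}{\binom{n_i}{2}}\ \text{ for all } i.$$ Let $(G_t)_{t\ge0}$, with adjacency matrices $(A_t)_{t\ge 0}$, be produced by the block edgelighter walk started from $G_0$ with these communities and with $1-q_{i;1}=q_{i;2}=q$ for all $i$, where $q\in(0,1)$ is fixed. Let $\beta\in(0,1)$ be constant, and define the event $$\mathcal{E}_{t,\beta}=\left\{\operatorname*{arg\,max}_{P\in\Pi_n}\operatorname{Tr}(A_0PA_tP^T)\subset\Pi_{B_1,\beta}\right\},$$ where $\Pi_{B_1,\beta}$ is the set of permutation matrices in which at most $n_1^\beta$ of the vertices of $B_1$ are shuffled. Let $N=n^{1+a_2}\log^{3/2}(n)$. Then for a suitable constant $C>0$, $$\mathbb{P}(\mathcal{E}_{N,\beta})\le O\left((2n_1^\beta)^{-n_1/(2n_1^\beta+1)}\right)+O\left((n_1n^*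 )^{-Cn^{a_2}}\right)+O\left(n^{2a_2}\log(n)\,b_4^{-n^{(1-a_2)/2}}\right)+O\left(n^{(a_2-1)/2}\right)+e^{-\Omega(n^{a_1}\log^{1/2}(n))}.$$
   Context: $\mathrm{SBM}(K,\Lambda,\tau)$: given $\tau:[n]\to[K]$ and a symmetric $\Lambda\in[0,1]^{K\times K}$, the random graph on $[n]$ in which each pair $\{u,v\}$ is an edge independently with probability $\Lambda_{\tau(u),\tau(v)}$; communities are $B_k=\tau^{-1}(k)$, $n_k=|B_k|$. The number of communities $K_n=b_4$ is a constant integer, at least 2. Block edgelighter walk: a time-homogeneous Markov chain $W_t$ on (community label) $\times$ (vertex) $\times\{0,1\}^{\binom V2}$, recording the walker's community, the walker's vertex, and the current graph $G_t$. If the walker is at vertex $u\in B_i$ at time $t$, then with probability $1/2$ each it stays in or leaves $B_i$. (i) If it stays, it selects $v\in B_i$ uniformly at random ($v=u$ allowed) and moves to $v$. If $v=u$ the graph is unchanged. If $v\neq u$, only the pair $\{u,v\}$ may change: if it is an edge it is removed with probability $q_{i;1}$ (otherwise kept), and if it is a non-edge it is added with probability $q_{i;2}$ (otherwise left absent), independently of the walk and of the graph history. (ii) If it leaves, it chooses a community $B_j\ne B_i$ uniformly at random among the other $K_n-1$ communities. It then independently selects a uniformly random edge $e_1$ and a uniformly random non-edge $e_2$ of the current graph between $B_i$ and $B_j$, turns $e_1$ into a non-edge and $e_2$ into an edge, and moves to a uniformly random vertex $w\in B_j$. (Convention: if there is no edge or no non-edge between $B_i$ and $B_j$, the graph is unchanged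 in this step.) All random choices are independent. The walker's initial vertex is arbitrary, independent of $G_0$. $\Pi_n$ is the set of $n\times n$ permutation matrices; a vertex is shuffled by a permutation if it is not fixed by it; $\operatorname{arg\,max}$ denotes the set of all maximizers. A non-integer time $N$ is read as its integer part. Asymptotics are as $n\to\infty$ with all the constants above fixed; $f=O(g)$ means $f(n)\le C'g(n)$ for some $C'>0$ and all large $n$, and $f=\Omega(g)$ means $g=O(f)$. *)

theory Defs
  imports
    "HOL-Probability.Probability"
    "HOL-Library.Landau_Symbols"
    "HOL-Combinatorics.Permutations"
    "Jordan_Normal_Form.Matrix"
begin

text \<open>
  The vertex set of an \<open>n\<close>-vertex graph is \<open>{..<n}\<close> (matching the index range of matrices), community
  labels are \<open>{1..K}\<close>, and a graph is identified with its edge set, a subset of \<open>vpairs n\<close>.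
\<close>

type_synonym graph = "nat set set"

definition vpairs :: "nat \<Rightarrow> nat set set" where
  "vpairs n = {{u, v} | u v. u < n \<and> v < n \<and> u \<noteq> v}"

definition block :: "nat \<Rightarrow> (nat \<Rightarrow> nat) \<Rightarrow> nat \<Rightarrow> nat set" where
  "block n \<tau> k = {v \<in> {..<n}. \<tau> v = k}"

definition bsize :: "nat \<Rightarrow> (nat \<Rightarrow> nat) \<Rightarrow> nat \<Rightarrow> nat" where
  "bsize n \<tau> k = card (block n \<tau> k)"

definition cross_pairs :: "nat \<Rightarrow> (nat \<Rightarrow> nat) \<Rightarrow> nat \<Rightarrow> nat \<Rightarrow> nat set set" where
  "cross_pairs n \<tau> i j = {{u, v} | u v. u \<in> block n \<tau> i \<and> v \<in> block n \<tau> j}"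

text \<open>
  The two endpoints of a pair \<open>e\<close> are recovered as \<open>Min e\<close> and \<open>Max e\<close>; their order is immaterial
  since \<open>\<Lambda>\<close> is assumed symmetric wherever this is used.
\<close>

definition sbm :: "nat \<Rightarrow> (nat \<Rightarrow> nat \<Rightarrow> real) \<Rightarrow> (nat \<Rightarrow> nat) \<Rightarrow> graph pmf" where
  "sbm n \<Lambda> \<tau> =
     map_pmf (\<lambda>f. {e \<in> vpairs n. f e})
       (Pi_pmf (vpairs n) False (\<lambda>e. bernoulli_pmf (\<Lambda> (\<tau> (Min e)) (\<tau> (Max e)))))"

text \<open>State of the walk: (community of the walker, vertex of the walker, current graph).\<close>

type_synonym walk_state = "nat \<times> nat \<times> graph"

definition stay_step ::
  "nat \<Rightarrow> (nat \<Rightarrow> nat) \<Rightarrow> (nat \<Rightarrow> real) \<Rightarrow> (nat \<Rightarrow> real) \<Rightarrow> walk_state \<Rightarrow> walk_state pmf" where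
  "stay_step n \<tau> q1 q2 = (\<lambda>(i, u, G).
     do {
       v \<leftarrow> pmf_of_set (block n \<tau> i);
       G' \<leftarrow> (if v = u then return_pmf G
             else if {u, v} \<in> G
             then map_pmf (\<lambda>b. if b then G - {{u, v}} else G) (bernoulli_pmf (q1 i))
             else map_pmf (\<lambda>b. if b then insert {u, v} G else G) (bernoulli_pmf (q2 i)));
       return_pmf (i, v, G')
     })"

definition swap_cross :: "nat \<Rightarrow> (nat \<Rightarrow> nat) \<Rightarrow> nat \<Rightarrow> nat \<Rightarrow> graph \<Rightarrow> graph pmf" where
  "swap_cross n \<tau> i j G =
     (let E = cross_pairs n \<tau> i j \<inter> G; E' = cross_pairs n \<tau> i j - G
      in if E = {} \<or> E' = {} then return_pmf G
         else do {
           e1 \<leftarrow> pmf_of_set E;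
           e2 \<leftarrow> pmf_of_set E';
           return_pmf (insert e2 (G - {e1}))
         })"

definition leave_step :: "nat \<Rightarrow> nat \<Rightarrow> (nat \<Rightarrow> nat) \<Rightarrow> walk_state \<Rightarrow> walk_state pmf" where
  "leave_step n K \<tau> = (\<lambda>(i, u, G).
     do {
       j \<leftarrow> pmf_of_set ({1..K} - {i});
       G' \<leftarrow> swap_cross n \<tau> i j G;
       w \<leftarrow> pmf_of_set (block n \<tau> j);
       return_pmf (j, w, G')
     })"

definition walk_step ::
  "nat \<Rightarrow> nat \<Rightarrow> (nat \<Rightarrow> nat) \<Rightarrow> (nat \<Rightarrow> real) \<Rightarrow> (nat \<Rightarrow> real) \<Rightarrow> walk_state \<Rightarrow> walk_state pmf" where
  "walk_step n K \<tau> q1 q2 s =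
     do {
       stay \<leftarrow> bernoulli_pmf (1 / 2);
       if stay then stay_step n \<tau> q1 q2 s else leave_step n K \<tau> s
     }"

primrec walk ::
  "nat \<Rightarrow> nat \<Rightarrow> (nat \<Rightarrow> nat) \<Rightarrow> (nat \<Rightarrow> real) \<Rightarrow> (nat \<Rightarrow> real) \<Rightarrow> nat \<Rightarrow> walk_state \<Rightarrow> walk_state pmf"
where
  "walk n K \<tau> q1 q2 0 s = return_pmf s"
| "walk n K \<tau> q1 q2 (Suc t) s = bind_pmf (walk n K \<tau> q1 q2 t s) (walk_step n K \<tau> q1 q2)"

text \<open>
  Joint law of \<open>(G\<^sub>0, G\<^sub>t)\<close>, where \<open>\<mu>\<close> is the law of the walker's initial vertex, drawn independently
  of \<open>G\<^sub>0\<close>.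
\<close>

definition walk_graphs ::
  "nat \<Rightarrow> nat \<Rightarrow> (nat \<Rightarrow> nat \<Rightarrow> real) \<Rightarrow> (nat \<Rightarrow> nat) \<Rightarrow> (nat \<Rightarrow> real) \<Rightarrow> (nat \<Rightarrow> real) \<Rightarrow> nat pmf \<Rightarrow>
   nat \<Rightarrow> (graph \<times> graph) pmf" where
  "walk_graphs n K \<Lambda> \<tau> q1 q2 \<mu> t =
     do {
       G0 \<leftarrow> sbm n \<Lambda> \<tau>;
       u \<leftarrow> \<mu>;
       (i, v, G) \<leftarrow> walk n K \<tau> q1 q2 t (\<tau> u, u, G0);
       return_pmf (G0, G)
     }"

definition adj_mat :: "nat \<Rightarrow> graph \<Rightarrow> real mat" where
  "adj_mat n G = Matrix.mat n n (\<lambda>(u, v). if {u, v} \<in> G then 1 else 0)"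

definition perm_mat :: "nat \<Rightarrow> (nat \<Rightarrow> nat) \<Rightarrow> real mat" where
  "perm_mat n \<sigma> = Matrix.mat n n (\<lambda>(u, v). if v = \<sigma> u then 1 else 0)"

definition mat_trace :: "real mat \<Rightarrow> real" where
  "mat_trace A = (\<Sum>i<dim_row A. A $$ (i, i))"

definition perm_mats :: "nat \<Rightarrow> real mat set" where
  "perm_mats n = {perm_mat n \<sigma> | \<sigma>. \<sigma> permutes {..<n}}"

definition perm_mats_shuffling :: "nat \<Rightarrow> nat set \<Rightarrow> real \<Rightarrow> real mat set" where
  "perm_mats_shuffling n B \<beta> =
     {perm_mat n \<sigma> | \<sigma>. \<sigma> permutes {..<n} \<and> real (card {v \<in> B. \<sigma> v \<noteq> v}) \<le> real (card B) powr \<beta>}"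

definition best_alignments :: "nat \<Rightarrow> graph \<Rightarrow> graph \<Rightarrow> real mat set" where
  "best_alignments n G H =
     {P. is_arg_max (\<lambda>P. mat_trace (adj_mat n G * P * adj_mat n H * transpose_mat P))
                    (\<lambda>P. P \<in> perm_mats n) P}"

definition align_event :: "nat \<Rightarrow> (nat \<Rightarrow> nat) \<Rightarrow> real \<Rightarrow> (graph \<times> graph) set" where
  "align_event n \<tau> \<beta> =
     {(G0, Gt). best_alignments n G0 Gt \<subseteq> perm_mats_shuffling n (block n \<tau> 1) \<beta>}"

text \<open>
  An equation between an integer-valued quantity and a real one, such as \<open>n\<^sub>1 = b\<^sub>1 n\<^bsup>a\<^esup>\<close> with \<open>0 < a < 1\<close>,
  cannot hold exactly for all large \<open>n\<close>; it is read up to rounding down or up.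
\<close>

definition rounds :: "nat \<Rightarrow> real \<Rightarrow> bool" where
  "rounds m x \<longleftrightarrow> int m = \<lfloor>x\<rfloor> \<or> int m = \<lceil>x\<rceil>"

end

theory Submission
  imports Defs "HOL-Real_Asymp.Real_Asymp"
begin

text \<open>
  Since \<open>1 - q\<^sub>1 = q\<^sub>2 = q\<close>, every visit to a pair inside a community resamples that pair as a
  Bernoulli(\<open>q\<close>) variable, and a crossing step is one step of the Bernoulli--Laplace chain on the
  cross pairs. Two copies of the walk whose graphs differ in one pair inside \<open>B\<^sub>1\<close>, or by one swap of
  pairs between \<open>B\<^sub>1\<close> and another community, can therefore be coupled so that two steps merge them
  with probability at least \<open>1 / (4 K\<^sup>2 M)\<close>, where \<open>M\<close> bounds \<open>n\<^sub>1 n\<^sub>j\<close> for all \<open>j\<close>. This is recorded dually,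
  as a contraction of Lipschitz constants. If \<open>\<sigma>\<close> permutes \<open>B\<^sub>1 - {u}\<close>, with \<open>u\<close> the starting vertex, then
  \<open>G\<^sub>0\<close> and \<open>\<sigma> G\<^sub>0\<close> are joined by at most \<open>n\<^sup>2\<close> such moves, so after \<open>N\<close> steps the laws started from them
  differ by at most \<open>n\<^sup>2 (1 - 1 / (4 K\<^sup>2 M))\<^bsup>N div 2\<^esup>\<close>, which is superpolynomially small because \<open>M\<close> is
  of order at most \<open>n\<^bsup>1 + a\<^sub>1\<^esup>\<close> and \<open>a\<^sub>1 < a\<^sub>2\<close>.

  By symmetry the walk from \<open>\<sigma> G\<^sub>0\<close> produces \<open>\<sigma> G\<^sub>N\<close>. If \<open>\<pi>\<close> aligns \<open>(G\<^sub>0, G\<^sub>N)\<close> optimally then \<open>\<sigma> \<circ> \<pi>\<close>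
  aligns \<open>(G\<^sub>0, \<sigma> G\<^sub>N)\<close> optimally, and for a uniformly random \<open>\<sigma>\<close> this fixes most of \<open>B\<^sub>1\<close> only with
  factorially small probability. The bound holds conditionally on \<open>G\<^sub>0\<close>, and the term of order
  \<open>n\<^bsup>(a\<^sub>2 - 1) / 2\<^esup>\<close> alone dominates it.
\<close>

section \<open>Random maps contracting along a relation\<close>

abbreviation expec :: "'a pmf \<Rightarrow> ('a \<Rightarrow> real) \<Rightarrow> real" where
  "expec p f \<equiv> measure_pmf.expectation p f"

lemma expec_bind:
  assumes "\<And>x. \<bar>f x\<bar> \<le> B"
  shows "expec (bind_pmf p k) f = expec p (\<lambda>x. expec (k x) f)"
  unfolding measure_pmf_bind
  apply (subst integral_bind[where K="count_space UNIV" and B'=1 and B=B])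
  using assms measurable_measure_pmf[of k]
  by (auto intro!: prob_space.finite_measure measure_pmf.prob_space_axioms
           simp: measure_pmf.emeasure_space_1)

lemma integrable_pmf_bounded:
  fixes f :: "'a \<Rightarrow> real"
  assumes "\<And>x. \<bar>f x\<bar> \<le> B"
  shows "integrable (measure_pmf p) f"
  using assms by (intro measure_pmf.integrable_const_bound[where B=B]) auto

lemma expec_abs_le:
  assumes "\<And>x. \<bar>f x\<bar> \<le> B"
  shows "\<bar>expec p f\<bar> \<le> B"
proof -
  have "\<bar>expec p f\<bar> \<le> expec p (\<lambda>x. \<bar>f x\<bar>)"
    by (rule integral_abs_bound)
  also have "\<dots> \<le> expec p (\<lambda>_. B)"
    using assms by (intro integral_mono integrable_pmf_bounded[where B=B]) (auto intro: order_trans[OF abs_ge_zero])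
  finally show ?thesis by simp
qed

text \<open>Dual (Kantorovich) form of a coupling estimate: averaging over \<open>U\<close>
  multiplies the oscillation of an observable along \<open>R\<close> by at most \<open>k\<close>.
  Estimates for successive steps then compose by iterating an operator on functions, and no coupling
  of whole trajectories has to be built.\<close>

definition contracts :: "('a \<times> 'a) set \<Rightarrow> ('a \<Rightarrow> 'a pmf) \<Rightarrow> real \<Rightarrow> bool" where
  "contracts R U k \<longleftrightarrow>
     (\<forall>\<phi> l. (\<exists>B. \<forall>x. \<bar>\<phi> x\<bar> \<le> B) \<longrightarrow> 0 \<le> l \<longrightarrow> (\<forall>(x, y)\<in>R. \<bar>\<phi> x - \<phi> y\<bar> \<le> l) \<longrightarrow>
        (\<forall>(x, y)\<in>R. \<bar>expec (U x) \<phi> - expec (U y) \<phi>\<bar> \<le> k * l))"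

lemma contractsD:
  assumes "contracts R U k" "\<And>x. \<bar>\<phi> x\<bar> \<le> B" "0 \<le> l"
    and "\<And>x y. (x, y) \<in> R \<Longrightarrow> \<bar>\<phi> x - \<phi> y\<bar> \<le> l" "(x, y) \<in> R"
  shows "\<bar>expec (U x) \<phi> - expec (U y) \<phi>\<bar> \<le> k * l"
  using assms unfolding contracts_def by blast

lemma contracts_mono:
  assumes "contracts R U k" "k \<le> k'" shows "contracts R U k'"
  unfolding contracts_def
proof (intro allI impI, clarify)
  fix \<phi> :: "'a \<Rightarrow> real" and l B :: real and x y
  assume B: "\<forall>x. \<bar>\<phi> x\<bar> \<le> B" and "0 \<le> l" and lip: "\<forall>(x, y)\<in>R. \<bar>\<phi> x - \<phi> y\<bar> \<le> l" and "(x, y) \<in> R"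
  then have "\<bar>expec (U x) \<phi> - expec (U y) \<phi>\<bar> \<le> k * l"
    by (intro contractsD[OF assms(1), where B=B]) auto
  also have "\<dots> \<le> k' * l" using assms(2) \<open>0 \<le> l\<close> by (rule mult_right_mono)
  finally show "\<bar>expec (U x) \<phi> - expec (U y) \<phi>\<bar> \<le> k' * l" .
qed

text \<open>Both laws are images of one random source \<open>p\<close>. Outcomes that have merged
  contribute nothing to the difference of expectations, and any other outcome is again a pair in
  \<open>R\<close> and contributes at most \<open>l\<close>; so the factor is governed by the
  probability of not merging.\<close>

lemma contracts_by_coupling:
  assumes "\<And>x y. (x, y) \<in> R \<Longrightarrow> \<exists>(p :: 'b pmf) a b. U x = map_pmf a p \<and> U y = map_pmf b p \<and>
     (\<forall>z\<in>set_pmf p. a z = b z \<or> (a z, b z) \<in> R) \<and> measure_pmf.prob p {z. a z \<noteq> b z} \<le> k"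
  shows "contracts R U k"
  unfolding contracts_def
proof (intro allI impI, clarify)
  fix \<phi> :: "'a \<Rightarrow> real" and l B :: real and x y
  assume B: "\<forall>x. \<bar>\<phi> x\<bar> \<le> B" and "0 \<le> l" and lip: "\<forall>(x, y)\<in>R. \<bar>\<phi> x - \<phi> y\<bar> \<le> l"
    and "(x, y) \<in> R"
  from assms[OF this(4)] obtain p :: "'b pmf" and a b where
    p: "U x = map_pmf a p" "U y = map_pmf b p" "\<forall>z\<in>set_pmf p. a z = b z \<or> (a z, b z) \<in> R"
       "measure_pmf.prob p {z. a z \<noteq> b z} \<le> k"
    by blast
  have int: "integrable p (\<lambda>z. \<phi> (a z))" "integrable p (\<lambda>z. \<phi> (b z))"
    using B by (auto intro!: integrable_pmf_bounded)
  have "\<bar>expec (U x) \<phi> - expec (U y) \<phi>\<bar> = \<bar>expec p (\<lambda>z. \<phi> (a z) - \<phi> (b z))\<bar>"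
    using int by (simp add: p)
  also have "\<dots> \<le> expec p (\<lambda>z. \<bar>\<phi> (a z) - \<phi> (b z)\<bar>)"
    by (rule integral_abs_bound)
  also have "\<dots> \<le> expec p (\<lambda>z. l * indicator {z. a z \<noteq> b z} z)"
  proof (rule integral_mono_AE)
    show "integrable p (\<lambda>z. \<bar>\<phi> (a z) - \<phi> (b z)\<bar>)" using int by auto
    show "integrable p (\<lambda>z. l * indicator {z. a z \<noteq> b z} z)"
      by (intro integrable_pmf_bounded[where B="\<bar>l\<bar>"]) (auto simp: indicator_def)
    show "AE z in p. \<bar>\<phi> (a z) - \<phi> (b z)\<bar> \<le> l * indicator {z. a z \<noteq> b z} z"
      unfolding AE_measure_pmf_iff using p(3) lip by (fastforce simp: indicator_def)
  qed
  also have "\<dots> = l * measure_pmf.prob p {z. a z \<noteq> b z}" by simp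
  also have "\<dots> \<le> k * l" using p(4) \<open>0 \<le> l\<close> by (subst mult.commute) (rule mult_right_mono)
  finally show "\<bar>expec (U x) \<phi> - expec (U y) \<phi>\<bar> \<le> k * l" .
qed

lemma contracts_one_by_coupling:
  assumes "\<And>x y. (x, y) \<in> R \<Longrightarrow> \<exists>(p :: 'b pmf) a b. U x = map_pmf a p \<and> U y = map_pmf b p \<and>
     (\<forall>z\<in>set_pmf p. a z = b z \<or> (a z, b z) \<in> R)"
  shows "contracts R U 1"
proof (rule contracts_by_coupling[where 'b='b])
  fix x y assume "(x, y) \<in> R"
  from assms[OF this] obtain p :: "'b pmf" and a b where
    p: "U x = map_pmf a p" "U y = map_pmf b p" "\<forall>z\<in>set_pmf p. a z = b z \<or> (a z, b z) \<in> R"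
    by blast
  show "\<exists>(p :: 'b pmf) a b. U x = map_pmf a p \<and> U y = map_pmf b p \<and>
     (\<forall>z\<in>set_pmf p. a z = b z \<or> (a z, b z) \<in> R) \<and> measure_pmf.prob p {z. a z \<noteq> b z} \<le> 1"
    by (rule exI[of _ p], rule exI[of _ a], rule exI[of _ b]) (simp add: p)
qed

lemma contracts_map_pmf:
  assumes "\<And>x y z. (x, y) \<in> R \<Longrightarrow> z \<in> set_pmf p \<Longrightarrow> (h x z, h y z) \<in> R"
  shows "contracts R (\<lambda>x. map_pmf (h x) p) 1"
  using assms by (intro contracts_one_by_coupling) blast

lemma contracts_return_pmf: "contracts R return_pmf 1"
  by (auto simp: contracts_def)

section \<open>Elementary graph moves: resampling a pair, and a Bernoulli--Laplace step on a class
  of pairs\<close>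

definition refresh :: "real \<Rightarrow> nat \<Rightarrow> nat \<Rightarrow> graph \<Rightarrow> graph pmf" where
  "refresh q u v G =
     (if u = v then return_pmf G
      else map_pmf (\<lambda>b. if b then insert {u, v} G else G - {{u, v}}) (bernoulli_pmf q))"

definition swap_in :: "nat set set \<Rightarrow> graph \<Rightarrow> graph pmf" where
  "swap_in X G =
     (if X \<inter> G = {} \<or> X - G = {} then return_pmf G
      else map_pmf (\<lambda>(e1, e2). insert e2 (G - {e1}))
             (pair_pmf (pmf_of_set (X \<inter> G)) (pmf_of_set (X - G))))"

lemma swap_cross_eq: "swap_cross n \<tau> i j = swap_in (cross_pairs n \<tau> i j)"
  by (auto simp: swap_cross_def swap_in_def Let_def fun_eq_iff map_pmf_def pair_pmf_def
        bind_assoc_pmf bind_return_pmf)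

definition differ_at :: "nat set \<Rightarrow> (graph \<times> graph) set" where
  "differ_at e = {(G, G'). G - {e} = G' - {e}}"

text \<open>Inside \<open>X\<close> this is adjacency in the Johnson graph on edge sets of a fixed
  size; outside \<open>X\<close> the two graphs agree.\<close>

definition one_swap :: "nat set set \<Rightarrow> (graph \<times> graph) set" where
  "one_swap X = {(G, G'). \<exists>x y. x \<in> X \<inter> G \<and> y \<in> X - G \<and> G' = insert y (G - {x})}"

lemma refresh_contracts_one:
  assumes "\<And>G G' e. (G, G') \<in> R \<Longrightarrow> e = {u, v} \<Longrightarrow> (insert e G, insert e G') \<in> R \<and> (G - {e}, G' - {e}) \<in> R"
  shows "contracts R (refresh q u v) 1"
proof (cases "u = v")
  case True
  then have "refresh q u v = return_pmf" by (simp add: refresh_def fun_eq_iff)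
  then show ?thesis by (simp add: contracts_return_pmf)
next
  case False
  then have "refresh q u v = (\<lambda>G. map_pmf (\<lambda>b. if b then insert {u, v} G else G - {{u, v}}) (bernoulli_pmf q))"
    by (simp add: refresh_def fun_eq_iff)
  then show ?thesis using assms by (auto intro!: contracts_map_pmf)
qed

lemma refresh_differ_at: "contracts (differ_at e) (refresh q u v) 1"
  by (rule refresh_contracts_one) (auto simp: differ_at_def)

text \<open>Resampling \<open>{u, v}\<close> erases the only possible difference, so the two
  resulting laws are equal.\<close>

lemma refresh_differ_at_same:
  assumes "u \<noteq> v"
  shows "contracts (differ_at {u, v}) (refresh q u v) 0"
  unfolding contracts_def
proof (intro allI impI, clarify)
  fix \<phi> :: "graph \<Rightarrow> real" and l :: real and G G' :: graph
  assume "(G, G') \<in> differ_at {u, v}"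
  then have eq: "G - {{u, v}} = G' - {{u, v}}" by (simp add: differ_at_def)
  have eq': "insert {u, v} G = insert {u, v} G'" using eq by blast
  have "refresh q u v G = refresh q u v G'"
    using assms by (simp only: refresh_def eq eq' if_False)
  then show "\<bar>expec (refresh q u v G) \<phi> - expec (refresh q u v G') \<phi>\<bar> \<le> 0 * l" by simp
qed

lemma refresh_one_swap:
  assumes "{u, v} \<notin> X"
  shows "contracts (one_swap X) (refresh q u v) 1"
proof (rule refresh_contracts_one)
  fix G G' e assume "(G, G') \<in> one_swap X" and e: "e = {u, v}"
  then obtain x y where xy: "x \<in> X" "x \<in> G" "y \<in> X" "y \<notin> G" "G' = insert y (G - {x})"
    by (auto simp: one_swap_def)
  have "e \<noteq> x" "e \<noteq> y" using xy e assms by auto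
  then have "insert e G' = insert y (insert e G - {x})" "G' - {e} = insert y ((G - {e}) - {x})"
    using xy(5) by auto
  then show "(insert e G, insert e G') \<in> one_swap X \<and> (G - {e}, G' - {e}) \<in> one_swap X"
    unfolding one_swap_def using xy \<open>e \<noteq> x\<close> \<open>e \<noteq> y\<close> by blast
qed

text \<open>Graphs that agree on \<open>X\<close> offer the same edges and non-edges for selection,
  so both copies can make the same choice \<open>(e1, e2)\<close>.\<close>

lemma swap_in_contracts_one:
  assumes fin: "finite X"
    and same: "\<And>G G'. (G, G') \<in> R \<Longrightarrow> X \<inter> G = X \<inter> G'"
    and closed: "\<And>G G' e1 e2. (G, G') \<in> R \<Longrightarrow> e1 \<in> X \<Longrightarrow> e2 \<in> X \<Longrightarrow>
      (insert e2 (G - {e1}), insert e2 (G' - {e1})) \<in> R"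
  shows "contracts R (swap_in X) 1"
proof (rule contracts_one_by_coupling)
  fix G G' assume R: "(G, G') \<in> R"
  note E = same[OF R]
  then have F: "X - G' = X - G" by blast
  show "\<exists>(p :: (nat set \<times> nat set) pmf) a b. swap_in X G = map_pmf a p \<and> swap_in X G' = map_pmf b p \<and>
          (\<forall>z\<in>set_pmf p. a z = b z \<or> (a z, b z) \<in> R)"
  proof (cases "X \<inter> G = {} \<or> X - G = {}")
    case True
    then have "swap_in X G = return_pmf G" "swap_in X G' = return_pmf G'"
      unfolding swap_in_def E F by simp_all
    then show ?thesis
      using R by (intro exI[of _ "return_pmf ({}, {})"] exI[of _ "\<lambda>_. G"] exI[of _ "\<lambda>_. G'"]) simp
  next
    case False
    let ?p = "pair_pmf (pmf_of_set (X \<inter> G)) (pmf_of_set (X - G))"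
    let ?a = "\<lambda>G (e1, e2). insert e2 (G - {e1})"
    have "swap_in X G = map_pmf (?a G) ?p" using False by (simp add: swap_in_def)
    moreover have "swap_in X G' = map_pmf (?a G') ?p"
      using False unfolding swap_in_def E F by simp
    moreover have "\<forall>z\<in>set_pmf ?p. ?a G z = ?a G' z \<or> (?a G z, ?a G' z) \<in> R"
    proof
      fix z assume "z \<in> set_pmf ?p"
      then have "fst z \<in> X" "snd z \<in> X" using False fin by auto
      from closed[OF R this] show "?a G z = ?a G' z \<or> (?a G z, ?a G' z) \<in> R"
        by (simp add: case_prod_unfold)
    qed
    ultimately show ?thesis
      by (intro exI[of _ ?p] exI[of _ "?a G"] exI[of _ "?a G'"] conjI)
  qed
qed

lemma swap_in_differ_at:
  assumes "finite X" "e \<notin> X"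
  shows "contracts (differ_at e) (swap_in X) 1"
  using assms by (intro swap_in_contracts_one) (auto simp: differ_at_def)

lemma swap_in_one_swap_disjoint:
  assumes "finite X" "X \<inter> Y = {}"
  shows "contracts (one_swap Y) (swap_in X) 1"
proof (rule swap_in_contracts_one)
  fix G G' assume "(G, G') \<in> one_swap Y"
  then obtain x y where xy: "x \<in> Y" "x \<in> G" "y \<in> Y" "y \<notin> G" "G' = insert y (G - {x})"
    by (auto simp: one_swap_def)
  show "X \<inter> G = X \<inter> G'" using xy assms(2) by auto
  fix e1 e2 assume "e1 \<in> X" "e2 \<in> X"
  then have "e1 \<noteq> x" "e1 \<noteq> y" "e2 \<noteq> x" "e2 \<noteq> y" using xy assms(2) by auto
  moreover from this have "insert e2 (G' - {e1}) = insert y (insert e2 (G - {e1}) - {x})"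
    using xy(5) by auto
  ultimately show "(insert e2 (G - {e1}), insert e2 (G' - {e1})) \<in> one_swap Y"
    unfolding one_swap_def using xy by blast
qed (use assms in auto)

lemma pair_pmf_of_set:
  assumes "A \<noteq> {}" "B \<noteq> {}" "finite A" "finite B"
  shows "pair_pmf (pmf_of_set A) (pmf_of_set B) = pmf_of_set (A \<times> B)"
proof (rule pmf_eqI)
  fix z :: "'a \<times> 'b"
  have "A \<times> B \<noteq> {}" using assms by blast
  then show "pmf (pair_pmf (pmf_of_set A) (pmf_of_set B)) z = pmf (pmf_of_set (A \<times> B)) z"
    using assms by (cases z) (simp add: pmf_pair pmf_of_set indicator_def)
qed

text \<open>With \<open>m\<close> edges and \<open>k\<close> non-edges, the numerator counts the
  choices for which the coupling of \<open>swap_in_one_swap\<close> may fail to merge. The claim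
  reduces to \<open>x * y \<le> (x + y) * (x + y - 2)\<close>, which follows from
  \<open>4 * (x * y) \<le> (x + y)^2\<close> once \<open>x + y \<ge> 3\<close>; it fails for
  \<open>m = k = 1\<close>.\<close>

lemma coupling_count_le:
  fixes m k :: nat
  assumes "1 \<le> m" "1 \<le> k" "3 \<le> m + k"
  shows "(real ((m - 1) * (k - 1) + 1)) / real (m * k) \<le> 1 - 1 / real (m + k)"
proof -
  define x y where "x = real m" and "y = real k"
  have xy: "x \<ge> 1" "y \<ge> 1" "x + y \<ge> 3" using assms by (auto simp: x_def y_def)
  have "4 * (x * y) \<le> (x + y)^2" using zero_le_power2[of "x - y"] by (simp add: power2_eq_square algebra_simps)
  also have "\<dots> \<le> 4 * ((x + y) * (x + y - 2))" 
  proof -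
    have "0 \<le> (x + y) * (3 * (x + y) - 8)" using xy by (intro mult_nonneg_nonneg) auto
    then show ?thesis by (simp add: power2_eq_square algebra_simps)
  qed
  finally have "x * y \<le> (x + y) * (x + y - 2)" by simp
  then have "((x - 1) * (y - 1) + 1) / (x * y) \<le> 1 - 1 / (x + y)"
    using xy by (simp add: field_simps)
  then show ?thesis using assms by (simp add: x_def y_def of_nat_diff add.commute)
qed

text \<open>The graphs differ by exchanging \<open>x\<close> for \<open>y\<close>, so the
  transposition of \<open>x\<close> and \<open>y\<close> carries the edges and non-edges of
  \<open>G\<close> in \<open>X\<close> to those of \<open>G'\<close>. The coupling selects
  \<open>(e1, e2)\<close> in \<open>G\<close> and the transposed pair in \<open>G'\<close>. The
  copies merge when exactly one of \<open>e1 = x\<close> and \<open>e2 = y\<close> holds, and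
  otherwise stay one swap apart.\<close>

lemma swap_in_one_swap:
  assumes fin: "finite X" and card: "card X \<ge> 3"
  shows "contracts (one_swap X) (swap_in X) (1 - 1 / real (card X))"
proof (rule contracts_by_coupling)
  fix G G' assume R: "(G, G') \<in> one_swap X"
  then obtain x y where xy: "x \<in> X" "x \<in> G" "y \<in> X" "y \<notin> G" and G': "G' = insert y (G - {x})"
    by (auto simp: one_swap_def)
  let ?E = "X \<inter> G" and ?F = "X - G"
  let ?f = "Transposition.transpose x y"
  have ne: "?E \<noteq> {}" "?F \<noteq> {}" and finE: "finite ?E" "finite ?F" using xy fin by auto
  have img: "?f ` A = insert b (A - {a})" if "a \<in> A" "b \<notin> A" "{a, b} = {x, y}" for A a b
  proof -
    have f: "?f a = b" using that(3) by (auto simp: doubleton_eq_iff)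
    have "?f ` (A - {a}) = (\<lambda>z. z) ` (A - {a})"
      using that by (intro image_cong refl transpose_apply_other) (auto simp: doubleton_eq_iff)
    then have "?f ` insert a (A - {a}) = insert b (A - {a})" by (simp only: image_insert f image_ident)
    then show ?thesis using that(1) by (simp add: insert_absorb)
  qed
  have "?f ` ?E = insert y (?E - {x})" "?f ` ?F = insert x (?F - {y})"
    using xy by (intro img; simp add: insert_commute)+
  moreover have "X \<inter> G' = insert y (?E - {x})" "X - G' = insert x (?F - {y})"
    unfolding G' using xy by blast+
  ultimately have E': "X \<inter> G' = ?f ` ?E" and F': "X - G' = ?f ` ?F" by simp_all
  let ?p = "pair_pmf (pmf_of_set ?E) (pmf_of_set ?F)"
  let ?a = "\<lambda>(e1, e2). insert e2 (G - {e1})"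
  let ?b = "\<lambda>(e1, e2). insert (?f e2) (G' - {?f e1})"
  have a: "swap_in X G = map_pmf ?a ?p" using ne by (simp add: swap_in_def)
  have inj: "inj_on ?f A" for A by (rule inj_on_subset[OF inj_transpose]) auto
  have "?f ` ?E \<noteq> {}" "?f ` ?F \<noteq> {}" using ne by auto
  then have "swap_in X G' = map_pmf (\<lambda>(e1, e2). insert e2 (G' - {e1}))
      (pair_pmf (pmf_of_set (?f ` ?E)) (pmf_of_set (?f ` ?F)))"
    unfolding swap_in_def E' F' by simp
  also have "pair_pmf (pmf_of_set (?f ` ?E)) (pmf_of_set (?f ` ?F)) = map_pmf (\<lambda>(c, d). (?f c, ?f d)) ?p"
    using ne finE by (simp add: map_pair map_pmf_of_set_inj[OF inj])
  finally have b: "swap_in X G' = map_pmf ?b ?p"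
    by (simp add: map_pmf_comp case_prod_unfold)
  \<comment> \<open>When both \<open>c = x\<close> and \<open>d = y\<close>, the copies trade
    places, which is again one swap; when neither holds, the old swap persists. In the two mixed
    cases the difference is removed.\<close>
  have key: "if (c = x) = (d = y) then (?a (c, d), ?b (c, d)) \<in> one_swap X else ?a (c, d) = ?b (c, d)"
    if "c \<in> ?E" "d \<in> ?F" for c d
  proof -
    have cd: "c \<in> X" "c \<in> G" "d \<in> X" "d \<notin> G" "c \<noteq> y" "d \<noteq> x" "x \<noteq> y" using that xy by auto
    have G: "insert x (G' - {y}) = G" using xy by (auto simp: G')
    consider "c = x" "d = y" | "c \<noteq> x" "d \<noteq> y" | "c = x" "d \<noteq> y" | "c \<noteq> x" "d = y" by blast
    then show ?thesis
    proof cases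
      case 1
      have "?a (c, d) = G'" "?b (c, d) = G" using 1 G by (simp_all add: G')
      moreover have "(G', G) \<in> one_swap X"
        unfolding one_swap_def using xy G[symmetric] G' cd(7) by blast
      ultimately show ?thesis using 1 by simp
    next
      case 2
      have "?f c = c" "?f d = d" using cd 2 by simp_all
      then have "?b (c, d) = insert y (?a (c, d) - {x})" using 2 cd by (auto simp: G')
      moreover have "x \<in> X \<inter> ?a (c, d)" "y \<in> X - ?a (c, d)" using xy cd 2 by auto
      ultimately show ?thesis using 2 unfolding one_swap_def by auto
    next
      case 3
      have "?f c = y" "?f d = d" using cd 3 by simp_all
      then have "?b (c, d) = ?a (c, d)" using 3 cd xy by (auto simp: G')
      then show ?thesis using 3 by simp
    next
      case 4
      have "?f c = c" "?f d = x" using cd 4 by simp_all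
      then have "?b (c, d) = ?a (c, d)" using 4 cd xy by (auto simp: G')
      then show ?thesis using 4 by simp
    qed
  qed
  have set: "set_pmf ?p = ?E \<times> ?F" using ne finE by simp
  let ?D = "{z. ?a z \<noteq> ?b z}"
  have "?p = pmf_of_set (?E \<times> ?F)"
    using ne finE by (intro pair_pmf_of_set)
  then have "measure_pmf.prob ?p ?D = real (card ((?E \<times> ?F) \<inter> ?D)) / real (card (?E \<times> ?F))"
    using ne finE by (simp only: measure_pmf_of_set) (simp add: measure_pmf_of_set)
  also have "\<dots> \<le> real ((card ?E - 1) * (card ?F - 1) + 1) / real (card ?E * card ?F)"
  proof -
    \<comment> \<open>A choice that does not merge the copies is \<open>(x, y)\<close> itself or
      avoids both \<open>x\<close> and \<open>y\<close>, whence the count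
      \<open>(card ?E - 1) * (card ?F - 1) + 1\<close>.\<close>
    have "(?E \<times> ?F) \<inter> ?D \<subseteq> insert (x, y) ((?E - {x}) \<times> (?F - {y}))"
      
    proof
      fix z assume z: "z \<in> (?E \<times> ?F) \<inter> ?D"
      obtain c d where cd: "z = (c, d)" by fastforce
      have "(c = x) = (d = y)"
        using key[of c d] z unfolding cd by (cases "(c = x) = (d = y)") simp_all
      then show "z \<in> insert (x, y) ((?E - {x}) \<times> (?F - {y}))" using z cd by auto
    qed
    then have "card ((?E \<times> ?F) \<inter> ?D) \<le> card (insert (x, y) ((?E - {x}) \<times> (?F - {y})))"
      using finE by (intro card_mono) auto
    also have "\<dots> \<le> card ((?E - {x}) \<times> (?F - {y})) + 1"
      using finE by (simp add: card_insert_if)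
    also have "\<dots> = (card ?E - 1) * (card ?F - 1) + 1"
      using finE xy by (simp add: card_cartesian_product)
    finally show ?thesis
      by (simp add: card_cartesian_product divide_right_mono del: of_nat_mult of_nat_add)
  qed
  also have "\<dots> \<le> 1 - 1 / real (card ?E + card ?F)"
  proof (rule coupling_count_le)
    show "1 \<le> card ?E" "1 \<le> card ?F" using ne finE by (simp_all add: Suc_le_eq card_gt_0_iff)
    have "card X = card ?E + card ?F"
      using finE by (subst card_Un_disjoint[symmetric]) (auto simp: Int_Diff_Un)
    then show "3 \<le> card ?E + card ?F" using card by simp
  qed
  also have "card ?E + card ?F = card X"
      using finE by (subst card_Un_disjoint[symmetric]) (auto simp: Int_Diff_Un)
  finally have prob: "measure_pmf.prob ?p ?D \<le> 1 - 1 / real (card X)" .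
  have "\<forall>z\<in>set_pmf ?p. ?a z = ?b z \<or> (?a z, ?b z) \<in> one_swap X"
    unfolding set
  proof
    fix z assume "z \<in> ?E \<times> ?F"
    then show "?a z = ?b z \<or> (?a z, ?b z) \<in> one_swap X"
      using key[of "fst z" "snd z"] by (cases "(fst z = x) = (snd z = y)") (simp_all add: mem_Times_iff)
  qed
  then show "\<exists>(p :: (nat set \<times> nat set) pmf) a b. swap_in X G = map_pmf a p \<and> swap_in X G' = map_pmf b p \<and>
          (\<forall>z\<in>set_pmf p. a z = b z \<or> (a z, b z) \<in> one_swap X) \<and>
          measure_pmf.prob p {z. a z \<noteq> b z} \<le> 1 - 1 / real (card X)"
    using a b prob by (intro exI[of _ ?p] exI[of _ ?a] exI[of _ ?b] conjI)
qed

lemma bernoulli_pmf_complement: "0 \<le> p \<Longrightarrow> p \<le> 1 \<Longrightarrow> bernoulli_pmf (1 - p) = map_pmf Not (bernoulli_pmf p)"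
proof (rule pmf_eqI)
  fix b :: bool assume p: "0 \<le> p" "p \<le> 1"
  have "pmf (map_pmf Not (bernoulli_pmf p)) (Not (\<not> b)) = pmf (bernoulli_pmf p) (\<not> b)"
    by (rule pmf_map_inj') (auto simp: inj_def)
  then show "pmf (bernoulli_pmf (1 - p)) b = pmf (map_pmf Not (bernoulli_pmf p)) b"
    using p by (cases b) simp_all
qed

lemma one_divide_le_one: "1 \<le> y \<Longrightarrow> 1 / y \<le> (1 :: real)"
  by (simp add: field_simps)

lemma sum_one_changed:
  fixes a b :: real
  assumes "finite A" "x \<in> A"
  shows "(\<Sum>y\<in>A. if y = x then a else b) = real (card A) * b - (b - a)"
proof -
  have "(\<Sum>y\<in>A. if y = x then a else b) = (\<Sum>y\<in>A. b) - (\<Sum>y\<in>A. if y = x then b - a else 0)"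
    unfolding sum_subtractf[symmetric] by (intro sum.cong) auto
  also have "(\<Sum>y\<in>A. if y = x then b - a else 0) = b - a" using assms by simp
  finally show ?thesis by simp
qed

section \<open>One step of the walk\<close>

text \<open>One walk at a fixed \<open>n\<close>. The law of the initial graph is not among the
  parameters, since the estimates are made for each starting graph. Nonempty blocks and
  \<open>K \<ge> 2\<close> make the uniform choices of vertices and communities well
  defined.\<close>

locale edgelighter =
  fixes n K :: nat and \<tau> :: "nat \<Rightarrow> nat" and q1 q2 :: "nat \<Rightarrow> real" and q :: real
  assumes K: "2 \<le> K"
    and labels: "\<And>v. v < n \<Longrightarrow> \<tau> v \<in> {1..K}"
    and rates: "\<And>i. i \<in> {1..K} \<Longrightarrow> 1 - q1 i = q \<and> q2 i = q"
    and q: "0 \<le> q" "q \<le> 1"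
    and blocks: "\<And>i. i \<in> {1..K} \<Longrightarrow> block n \<tau> i \<noteq> {}"
begin

abbreviation "B \<equiv> block n \<tau>"
abbreviation "X \<equiv> cross_pairs n \<tau>"

text \<open>The transition operator of the walk acting on observables; its powers give expectations
  at later times.\<close>

definition push :: "(walk_state \<Rightarrow> real) \<Rightarrow> walk_state \<Rightarrow> real" where
  "push f s = expec (walk_step n K \<tau> q1 q2 s) f"

lemma other_communities: "{1..K} - {i} \<noteq> {}"
proof
  assume "{1..K} - {i} = {}"
  then have "card {1..K} \<le> card {i}" by (intro card_mono) auto
  then show False using K by simp
qed

lemma finite_block [simp]: "finite (B i)"
  by (simp add: block_def)

lemma card_block_pos: "i \<in> {1..K} \<Longrightarrow> card (B i) > 0"
  using blocks by (simp add: card_gt_0_iff)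

lemma finite_cross [simp]: "finite (X i j)"
proof -
  have "X i j = (\<lambda>(u, v). {u, v}) ` (B i \<times> B j)" by (auto simp: cross_pairs_def)
  then show ?thesis by simp
qed

lemma push_abs_le: "(\<And>s. \<bar>f s\<bar> \<le> c) \<Longrightarrow> \<bar>push f s\<bar> \<le> c"
  unfolding push_def by (rule expec_abs_le)

lemma funpow_push_abs_le: "(\<And>s. \<bar>f s\<bar> \<le> c) \<Longrightarrow> \<bar>(push ^^ t) f s\<bar> \<le> c"
  by (induction t arbitrary: s) (auto intro: push_abs_le)

text \<open>\<open>walk\<close> appends its last step at the end, so that step is integrated out
  first and the induction hypothesis is applied to \<open>push f\<close>; hence the generalisation
  over \<open>f\<close>.\<close>

lemma expec_walk:
  assumes "\<And>s. \<bar>f s\<bar> \<le> c"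
  shows "expec (walk n K \<tau> q1 q2 t s) f = (push ^^ t) f s"
  using assms
proof (induction t arbitrary: f)
  case (Suc t)
  have "expec (walk n K \<tau> q1 q2 (Suc t) s) f = expec (walk n K \<tau> q1 q2 t s) (push f)"
    using Suc.prems by (simp add: expec_bind[where B=c] push_def[abs_def])
  also have "\<dots> = (push ^^ t) (push f) s"
    using Suc.prems by (intro Suc.IH push_abs_le)
  finally show ?case by (simp add: funpow_swap1)
qed simp

text \<open>With removal rate \<open>1 - q\<close> and insertion rate \<open>q\<close>, the visited
  pair ends up present with probability \<open>q\<close> whether or not it was an edge before, so
  both branches collapse to one resampling.\<close>

lemma stay_step_eq:
  assumes "i \<in> {1..K}"
  shows "stay_step n \<tau> q1 q2 (i, u, G) =
    bind_pmf (pmf_of_set (B i)) (\<lambda>v. map_pmf (\<lambda>G'. (i, v, G')) (refresh q u v G))"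
proof -
  have q12: "q1 i = 1 - q" "q2 i = q" using rates[OF assms] by auto
  have "(if v = u then return_pmf G
             else if {u, v} \<in> G
             then map_pmf (\<lambda>b. if b then G - {{u, v}} else G) (bernoulli_pmf (q1 i))
             else map_pmf (\<lambda>b. if b then insert {u, v} G else G) (bernoulli_pmf (q2 i)))
      = refresh q u v G" for v
  proof -
    have "map_pmf (\<lambda>b. if b then G - {{u, v}} else G) (bernoulli_pmf (1 - q))
       = map_pmf (\<lambda>b. if b then insert {u, v} G else G - {{u, v}}) (bernoulli_pmf q)" if "{u, v} \<in> G"
      using that q by (subst bernoulli_pmf_complement) (auto simp: map_pmf_comp insert_absorb intro!: map_pmf_cong)
    moreover have "map_pmf (\<lambda>b. if b then insert {u, v} G else G) (bernoulli_pmf q)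
       = map_pmf (\<lambda>b. if b then insert {u, v} G else G - {{u, v}}) (bernoulli_pmf q)" if "{u, v} \<notin> G"
      using that by (auto intro!: map_pmf_cong)
    ultimately show ?thesis by (auto simp: refresh_def q12)
  qed
  then show ?thesis by (simp add: stay_step_def map_pmf_def)
qed

lemma push_eq:
  assumes f: "\<And>s. \<bar>f s\<bar> \<le> c" and i: "i \<in> {1..K}"
  shows "push f (i, u, G) =
      (\<Sum>v\<in>B i. expec (refresh q u v G) (\<lambda>G'. f (i, v, G'))) / real (card (B i)) / 2
    + (\<Sum>j\<in>{1..K} - {i}. expec (swap_in (X i j) G) (\<lambda>G'. (\<Sum>w\<in>B j. f (j, w, G')) / real (card (B j))))
        / real (K - 1) / 2"
proof -
  have "expec (stay_step n \<tau> q1 q2 (i, u, G)) f =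
      (\<Sum>v\<in>B i. expec (refresh q u v G) (\<lambda>G'. f (i, v, G'))) / real (card (B i))"
    unfolding stay_step_eq[OF i] using blocks[OF i] f
    by (subst expec_bind[where B=c]) (simp_all add: integral_pmf_of_set)
  moreover have "expec (leave_step n K \<tau> (i, u, G)) f =
     (\<Sum>j\<in>{1..K} - {i}. expec (swap_in (X i j) G) (\<lambda>G'. (\<Sum>w\<in>B j. f (j, w, G')) / real (card (B j))))
        / real (K - 1)"
  proof -
    note ne = other_communities[of i]
    have "expec (leave_step n K \<tau> (i, u, G)) f =
      expec (pmf_of_set ({1..K} - {i})) (\<lambda>j. expec (swap_in (X i j) G)
         (\<lambda>G'. expec (pmf_of_set (B j)) (\<lambda>w. f (j, w, G'))))"
      using f unfolding leave_step_def swap_cross_eq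
      by (simp add: expec_bind[where B=c])
    also have "\<dots> = (\<Sum>j\<in>{1..K} - {i}. expec (swap_in (X i j) G) (\<lambda>G'. expec (pmf_of_set (B j)) (\<lambda>w. f (j, w, G'))))
        / real (K - 1)"
      using ne i by (simp add: integral_pmf_of_set)
    also have "\<dots> = (\<Sum>j\<in>{1..K} - {i}. expec (swap_in (X i j) G) (\<lambda>G'. (\<Sum>w\<in>B j. f (j, w, G')) / real (card (B j))))
        / real (K - 1)"
      using blocks by (intro arg_cong2[where f="(/)"] sum.cong refl) (simp add: integral_pmf_of_set)
    finally show ?thesis .
  qed
  moreover have "push f (i, u, G) = expec (stay_step n \<tau> q1 q2 (i, u, G)) f / 2 + expec (leave_step n K \<tau> (i, u, G)) f / 2"
    unfolding push_def walk_step_def using f by (subst expec_bind[where B=c]) simp_all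
  ultimately show ?thesis by simp
qed

text \<open>Both copies of the walker make the same moves. \<open>k v\<close> and \<open>r j\<close>
  are the factors supplied by the graph update of each move, and \<open>L\<close> is a Lipschitz
  constant that may depend on the walker's next position; the bound averages their products over
  that position.\<close>

lemma push_lipschitz:
  assumes f: "\<And>s. \<bar>f s\<bar> \<le> c" and i: "i \<in> {1..K}"
    and stay: "\<And>v. v \<in> B i \<Longrightarrow> contracts R (refresh q u v) (k v)"
    and leave: "\<And>j. j \<in> {1..K} \<Longrightarrow> j \<noteq> i \<Longrightarrow> contracts R (swap_in (X i j)) (r j)"
    and L: "\<And>j w G G'. j \<in> {1..K} \<Longrightarrow> w \<in> B j \<Longrightarrow> (G, G') \<in> R \<Longrightarrow> \<bar>f (j, w, G) - f (j, w, G')\<bar> \<le> L j w"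
    and L0: "\<And>j w. 0 \<le> L j w"
    and R: "(G, G') \<in> R"
  shows "\<bar>push f (i, u, G) - push f (i, u, G')\<bar> \<le>
      (\<Sum>v\<in>B i. k v * L i v) / real (card (B i)) / 2
    + (\<Sum>j\<in>{1..K} - {i}. r j * ((\<Sum>w\<in>B j. L j w) / real (card (B j)))) / real (K - 1) / 2"
proof -
  let ?S = "\<lambda>G v. expec (refresh q u v G) (\<lambda>G'. f (i, v, G'))"
  let ?T = "\<lambda>G j. expec (swap_in (X i j) G) (\<lambda>G'. (\<Sum>w\<in>B j. f (j, w, G')) / real (card (B j)))"
  have S: "\<bar>?S G v - ?S G' v\<bar> \<le> k v * L i v" if "v \<in> B i" for v
    by (rule contractsD[OF stay[OF that] _ L0 _ R, where B=c]) (use f L i that in auto)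
  have avg: "\<bar>sum h A / real (card A)\<bar> \<le> d" if "\<And>w. \<bar>h w\<bar> \<le> d" for h d and A :: "nat set"
  proof -
    have "d \<ge> 0" using that[of 0] by simp
    have "\<bar>sum h A\<bar> \<le> (\<Sum>w\<in>A. d)" by (rule order_trans[OF sum_abs sum_mono]) (rule that)
    then show ?thesis using \<open>d \<ge> 0\<close> by (cases "card A = 0") (simp_all add: field_simps)
  qed
  have T: "\<bar>?T G j - ?T G' j\<bar> \<le> r j * ((\<Sum>w\<in>B j. L j w) / real (card (B j)))" if "j \<in> {1..K} - {i}" for j
  proof (rule contractsD[OF leave _ _ _ R, where B=c])
    show "j \<in> {1..K}" "j \<noteq> i" using that by auto
    show "\<bar>(\<Sum>w\<in>B j. f (j, w, x)) / real (card (B j))\<bar> \<le> c" for x by (rule avg) (rule f)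
    show "0 \<le> (\<Sum>w\<in>B j. L j w) / real (card (B j))" using L0 by (simp add: sum_nonneg)
    fix x y assume "(x, y) \<in> R"
    then have "\<bar>(\<Sum>w\<in>B j. f (j, w, x)) - (\<Sum>w\<in>B j. f (j, w, y))\<bar> \<le> (\<Sum>w\<in>B j. L j w)"
      unfolding sum_subtractf[symmetric] using that
      by (intro order_trans[OF sum_abs sum_mono] L) auto
    then show "\<bar>(\<Sum>w\<in>B j. f (j, w, x)) / real (card (B j)) - (\<Sum>w\<in>B j. f (j, w, y)) / real (card (B j))\<bar>
         \<le> (\<Sum>w\<in>B j. L j w) / real (card (B j))"
      by (simp add: diff_divide_distrib[symmetric] divide_right_mono)
  qed
  have "\<bar>(\<Sum>v\<in>B i. ?S G v) - (\<Sum>v\<in>B i. ?S G' v)\<bar> \<le> (\<Sum>v\<in>B i. k v * L i v)"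
    unfolding sum_subtractf[symmetric] by (intro order_trans[OF sum_abs sum_mono] S)
  then have 1: "\<bar>(\<Sum>v\<in>B i. ?S G v) / real (card (B i)) / 2 - (\<Sum>v\<in>B i. ?S G' v) / real (card (B i)) / 2\<bar>
      \<le> (\<Sum>v\<in>B i. k v * L i v) / real (card (B i)) / 2"
    by (simp add: diff_divide_distrib[symmetric] divide_right_mono)
  have "\<bar>(\<Sum>j\<in>{1..K} - {i}. ?T G j) - (\<Sum>j\<in>{1..K} - {i}. ?T G' j)\<bar>
     \<le> (\<Sum>j\<in>{1..K} - {i}. r j * ((\<Sum>w\<in>B j. L j w) / real (card (B j))))"
    unfolding sum_subtractf[symmetric] by (intro order_trans[OF sum_abs sum_mono] T)
  then have 2: "\<bar>(\<Sum>j\<in>{1..K} - {i}. ?T G j) / real (K - 1) / 2 - (\<Sum>j\<in>{1..K} - {i}. ?T G' j) / real (K - 1) / 2\<bar>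
     \<le> (\<Sum>j\<in>{1..K} - {i}. r j * ((\<Sum>w\<in>B j. L j w) / real (card (B j)))) / real (K - 1) / 2"
    by (simp add: diff_divide_distrib[symmetric] divide_right_mono)
  show ?thesis
    unfolding push_eq[OF f i] by (rule order_trans[OF abs_diff_triangle_ineq add_mono[OF 1 2]])
qed

end

section \<open>Lipschitz constants of observables along the walk\<close>

context edgelighter
begin

text \<open>The labels occurring in a pair identify its class; this separates cross pairs from pairs
  inside a community and distinct classes of cross pairs from each other.\<close>

lemma image_cross_pair: "e \<in> X i j \<Longrightarrow> \<tau> ` e = {i, j}"
  by (auto simp: cross_pairs_def block_def)

lemma pair_notin_cross: "u \<in> B i \<Longrightarrow> v \<in> B i \<Longrightarrow> j \<noteq> k \<Longrightarrow> {u, v} \<notin> X j k"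
  using image_cross_pair[of "{u, v}" j k] by (auto simp: block_def)

lemma cross_pairs_commute: "X i j = X j i"
  by (auto simp: cross_pairs_def insert_commute)

lemma cross_pairs_disjoint:
  assumes "{i, j} \<noteq> {k, l}" shows "X i j \<inter> X k l = {}"
  using assms image_cross_pair by (metis disjoint_iff)

definition lipschitz :: "(graph \<times> graph) set \<Rightarrow> real \<Rightarrow> (walk_state \<Rightarrow> real) \<Rightarrow> bool" where
  "lipschitz R l f \<longleftrightarrow>
     (\<forall>i\<in>{1..K}. \<forall>u\<in>B i. \<forall>(G, G')\<in>R. \<bar>f (i, u, G) - f (i, u, G')\<bar> \<le> l)"

definition preserved :: "(graph \<times> graph) set \<Rightarrow> bool" where
  "preserved R \<longleftrightarrow>
     (\<forall>i\<in>{1..K}. \<forall>u\<in>B i. \<forall>v\<in>B i. contracts R (refresh q u v) 1) \<and>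
     (\<forall>i\<in>{1..K}. \<forall>j\<in>{1..K}. i \<noteq> j \<longrightarrow> contracts R (swap_in (X i j)) 1)"

lemma lipschitzD:
  "lipschitz R l f \<Longrightarrow> i \<in> {1..K} \<Longrightarrow> u \<in> B i \<Longrightarrow> (G, G') \<in> R \<Longrightarrow> \<bar>f (i, u, G) - f (i, u, G')\<bar> \<le> l"
  unfolding lipschitz_def by blast

lemma preservedD:
  assumes "preserved R" "i \<in> {1..K}"
  shows "u \<in> B i \<Longrightarrow> v \<in> B i \<Longrightarrow> contracts R (refresh q u v) 1"
    and "j \<in> {1..K} \<Longrightarrow> j \<noteq> i \<Longrightarrow> contracts R (swap_in (X i j)) 1"
proof -
  have "\<forall>u\<in>B i. \<forall>v\<in>B i. contracts R (refresh q u v) 1"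
    using assms unfolding preserved_def by (elim conjE) (erule (1) bspec)
  then show "u \<in> B i \<Longrightarrow> v \<in> B i \<Longrightarrow> contracts R (refresh q u v) 1" by simp
  have "\<forall>j\<in>{1..K}. i \<noteq> j \<longrightarrow> contracts R (swap_in (X i j)) 1"
    using assms unfolding preserved_def by (elim conjE) (erule (1) bspec)
  then show "j \<in> {1..K} \<Longrightarrow> j \<noteq> i \<Longrightarrow> contracts R (swap_in (X i j)) 1" by simp
qed

lemma push_lipschitz_preserved:
  assumes R: "preserved R" and f: "\<And>s. \<bar>f s\<bar> \<le> c" and lip: "lipschitz R l f" and l: "0 \<le> l"
  shows "lipschitz R l (push f)"
  unfolding lipschitz_def
proof (intro ballI, clarify)
  fix i u G G' assume i: "i \<in> {1..K}" and u: "u \<in> B i" and GG: "(G, G') \<in> R"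
  have "\<bar>push f (i, u, G) - push f (i, u, G')\<bar> \<le>
      (\<Sum>v\<in>B i. 1 * l) / real (card (B i)) / 2
    + (\<Sum>j\<in>{1..K} - {i}. 1 * ((\<Sum>w\<in>B j. l) / real (card (B j)))) / real (K - 1) / 2"
  proof (rule push_lipschitz[OF f i _ _ _ _ GG])
    show "contracts R (refresh q u v) 1" if "v \<in> B i" for v by (rule preservedD(1)[OF R i u that])
    show "contracts R (swap_in (X i j)) 1" if "j \<in> {1..K}" "j \<noteq> i" for j by (rule preservedD(2)[OF R i that])
    show "\<bar>f (j, w, G) - f (j, w, G')\<bar> \<le> l" if "j \<in> {1..K}" "w \<in> B j" "(G, G') \<in> R" for j w G G'
      by (rule lipschitzD[OF lip that])
  qed (rule l)
  also have "(\<Sum>j\<in>{1..K} - {i}. 1 * ((\<Sum>w\<in>B j. l) / real (card (B j)))) = (\<Sum>j\<in>{1..K} - {i}. l)"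
    using blocks by (intro sum.cong) auto
  also have "\<dots> = real (K - 1) * l" using i by simp
  also have "(\<Sum>v\<in>B i. 1 * l) / real (card (B i)) / 2 + real (K - 1) * l / real (K - 1) / 2 = l"
    using K blocks[OF i] by simp
  finally show "\<bar>push f (i, u, G) - push f (i, u, G')\<bar> \<le> l" .
qed

text \<open>From any position the walker enters community 1 in one step with probability at least
  \<open>1 / (2 K)\<close>, so a gain in the Lipschitz constant over community 1 spreads to all positions.\<close>

lemma push_lipschitz_gain:
  assumes R: "preserved R" and g: "\<And>s. \<bar>g s\<bar> \<le> c" and lip: "lipschitz R l g" and l: "0 \<le> l"
    and D: "\<And>w G G'. w \<in> B 1 \<Longrightarrow> (G, G') \<in> R \<Longrightarrow> \<bar>g (1, w, G) - g (1, w, G')\<bar> \<le> D w"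
    and D0: "\<And>w. 0 \<le> D w"
    and gain: "(\<Sum>w\<in>B 1. D w) / real (card (B 1)) \<le> (1 - \<gamma>) * l" and \<gamma>: "0 \<le> \<gamma>"
  shows "lipschitz R ((1 - \<gamma> / (2 * real K)) * l) (push g)"
  unfolding lipschitz_def
proof (intro ballI, clarify)
  fix i u G G' assume i: "i \<in> {1..K}" and u: "u \<in> B i" and GG: "(G, G') \<in> R"
  let ?L = "\<lambda>j w. if j = 1 then D w else l"
  let ?A = "\<lambda>j. (\<Sum>w\<in>B j. ?L j w) / real (card (B j))"
  have A1: "?A 1 \<le> (1 - \<gamma>) * l" using gain by simp
  have A: "?A j = l" if "j \<in> {1..K}" "j \<noteq> 1" for j
    using that blocks[of j] by simp
  have "\<bar>push g (i, u, G) - push g (i, u, G')\<bar> \<le>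
      (\<Sum>v\<in>B i. 1 * ?L i v) / real (card (B i)) / 2
    + (\<Sum>j\<in>{1..K} - {i}. 1 * ?A j) / real (K - 1) / 2"
  proof (rule push_lipschitz[OF g i _ _ _ _ GG])
    show "contracts R (refresh q u v) 1" if "v \<in> B i" for v by (rule preservedD(1)[OF R i u that])
    show "contracts R (swap_in (X i j)) 1" if "j \<in> {1..K}" "j \<noteq> i" for j by (rule preservedD(2)[OF R i that])
    show "\<bar>g (j, w, G) - g (j, w, G')\<bar> \<le> ?L j w" if "j \<in> {1..K}" "w \<in> B j" "(G, G') \<in> R" for j w G G'
      using lipschitzD[OF lip that] D that by auto
    show "0 \<le> ?L j w" for j w using l D0 by simp
  qed
  then have le: "\<bar>push g (i, u, G) - push g (i, u, G')\<bar> \<le>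
      ?A i / 2 + (\<Sum>j\<in>{1..K} - {i}. ?A j) / real (K - 1) / 2" by simp
  show "\<bar>push g (i, u, G) - push g (i, u, G')\<bar> \<le> (1 - \<gamma> / (2 * real K)) * l"
  proof (cases "i = 1")
    case True
    have "(\<Sum>j\<in>{1..K} - {i}. ?A j) = (\<Sum>j\<in>{1..K} - {i}. l)"
      using True A by (intro sum.cong) auto
    also have "\<dots> = real (K - 1) * l" using i by simp
    finally have "\<bar>push g (i, u, G) - push g (i, u, G')\<bar> \<le> ?A i / 2 + l / 2"
      using le K by simp
    also have "\<dots> \<le> (1 - \<gamma>) * l / 2 + l / 2" using A1 True by simp
    also have "\<dots> = l - \<gamma> * l / 2" by (simp add: field_simps)
    also have "\<dots> \<le> l - \<gamma> * l / (2 * real K)"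
      using K \<gamma> l by (intro diff_left_mono divide_left_mono) auto
    finally show ?thesis by (simp add: field_simps)
  next
    case False
    have "(\<Sum>j\<in>{1..K} - {i}. ?A j) \<le> (\<Sum>j\<in>{1..K} - {i}. if j = 1 then (1 - \<gamma>) * l else l)"
    proof (intro sum_mono)
      fix j assume j: "j \<in> {1..K} - {i}"
      show "?A j \<le> (if j = 1 then (1 - \<gamma>) * l else l)"
      proof (cases "j = 1")
        case True then show ?thesis using A1 by (simp only: simp_thms if_True)
      next
        case False then show ?thesis using A[of j] j by simp
      qed
    qed
    also have "\<dots> = real (K - 1) * l - \<gamma> * l"
      using False i K by (subst sum_one_changed) (auto simp: algebra_simps)
    finally have "(\<Sum>j\<in>{1..K} - {i}. ?A j) / real (K - 1) / 2 \<le> (real (K - 1) * l - \<gamma> * l) / real (K - 1) / 2"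
      by (simp add: divide_right_mono)
    also have "\<dots> = l / 2 - \<gamma> * l / (2 * real (K - 1))" using K by (simp add: field_simps)
    also have "\<dots> \<le> l / 2 - \<gamma> * l / (2 * real K)"
      using K \<gamma> l by (intro diff_left_mono divide_left_mono) auto
    finally have "\<bar>push g (i, u, G) - push g (i, u, G')\<bar> \<le> ?A i / 2 + (l / 2 - \<gamma> * l / (2 * real K))"
      by (rule order_trans[OF le add_left_mono])
    also have "?A i = l" using A i False by simp
    finally show ?thesis by (simp add: field_simps)
  qed
qed

lemma preserved_differ_at:
  assumes "a \<in> B i" "b \<in> B i"
  shows "preserved (differ_at {a, b})"
  unfolding preserved_def using pair_notin_cross[OF assms]
  by (auto intro!: refresh_differ_at swap_in_differ_at)

text \<open>Resampled pairs lie inside a community and swaps in another class touch disjoint pairs,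
  so both commute with the swap in \<open>X 1 j\<close>. A step in \<open>X 1 j\<close> itself is
  handled by \<open>swap_in_one_swap\<close>, which is where three pairs are required.\<close>

lemma preserved_one_swap:
  assumes "1 \<noteq> j" "card (X 1 j) \<ge> 3"
  shows "preserved (one_swap (X 1 j))"
  unfolding preserved_def
proof (intro conjI ballI impI)
  fix i u v assume "u \<in> B i" "v \<in> B i"
  then show "contracts (one_swap (X 1 j)) (refresh q u v) 1"
    using assms(1) by (intro refresh_one_swap pair_notin_cross)
next
  fix i k :: nat assume "i \<noteq> k"
  show "contracts (one_swap (X 1 j)) (swap_in (X i k)) 1"
  proof (cases "{i, k} = {1, j}")
    case True
    then have "X i k = X 1 j" using cross_pairs_commute by (auto simp: doubleton_eq_iff)
    then show ?thesis using swap_in_one_swap[of "X 1 j"] assms(2) by (auto intro: contracts_mono)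
  next
    case False
    then show ?thesis by (intro swap_in_one_swap_disjoint cross_pairs_disjoint) auto
  qed
qed

section \<open>Contraction over two steps\<close>

lemma one_in: "1 \<in> {1..K}" using K by simp

text \<open>The differing pair is resampled if one step brings the walker to \<open>a\<close> and
  the next one stays in community 1 and selects \<open>b\<close>. Write \<open>m\<close> for the
  size of \<open>B 1\<close>. The second step, which is the inner \<open>push\<close>, gains
  \<open>1 / (2 * m)\<close> at position \<open>a\<close>, hence \<open>1 / (2 * m^2)\<close> on
  average over \<open>B 1\<close>; the first step enters community 1 with probability at least
  \<open>1 / (2 * K)\<close>.\<close>

lemma two_steps_differ_at:
  assumes ab: "a \<in> B 1" "b \<in> B 1" "a \<noteq> b" and f: "\<And>s. \<bar>f s\<bar> \<le> c"
    and lip: "lipschitz (differ_at {a, b}) l f" and l: "0 \<le> l"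
  shows "lipschitz (differ_at {a, b}) ((1 - 1 / (4 * real K * real (card (B 1))^2)) * l) (push (push f))"
proof -
  let ?R = "differ_at {a, b}" and ?m = "real (card (B 1))"
  have Km: "real (K - 1) > 0" using K by simp
  have m: "?m \<ge> 1" using card_block_pos[OF one_in] by linarith
  let ?D = "\<lambda>w. if w = a then (1 - 1 / (2 * ?m)) * l else l"
  have lip': "lipschitz ?R l (push f)"
    by (rule push_lipschitz_preserved[OF preserved_differ_at[OF ab(1,2)] f lip l])
  have at_a: "\<bar>push f (1, a, G) - push f (1, a, G')\<bar> \<le> (1 - 1 / (2 * ?m)) * l" if "(G, G') \<in> ?R" for G G'
  proof -
    have "\<bar>push f (1, a, G) - push f (1, a, G')\<bar> \<le>
       (\<Sum>v\<in>B 1. (if v = b then 0 else 1) * l) / ?m / 2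
     + (\<Sum>j\<in>{1..K} - {1}. 1 * ((\<Sum>w\<in>B j. l) / real (card (B j)))) / real (K - 1) / 2"
    proof (rule push_lipschitz[OF f one_in _ _ _ _ that])
      fix v assume v: "v \<in> B 1"
      show "contracts ?R (refresh q a v) (if v = b then 0 else 1)"
        using refresh_differ_at_same[OF ab(3)] refresh_differ_at by auto
    next
      fix j assume "j \<in> {1..K}" "j \<noteq> 1"
      then show "contracts ?R (swap_in (X 1 j)) 1"
        using pair_notin_cross[OF ab(1,2)] by (intro swap_in_differ_at) auto
    qed (use l lipschitzD[OF lip] in auto)
    also have "(\<Sum>v\<in>B 1. (if v = b then 0 else 1) * l) = (\<Sum>v\<in>B 1. if v = b then 0 else l)"
      by (intro sum.cong) auto
    also have "\<dots> = ?m * l - l" using ab by (subst sum_one_changed) auto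
    also have "(\<Sum>j\<in>{1..K} - {1}. 1 * ((\<Sum>w\<in>B j. l) / real (card (B j)))) = (\<Sum>j\<in>{1..K} - {1}. l)"
      using blocks by (intro sum.cong) auto
    also have "\<dots> = real (K - 1) * l" using K by simp
    also have "(?m * l - l) / ?m / 2 + real (K - 1) * l / real (K - 1) / 2 = (1 - 1 / (2 * ?m)) * l"
    proof -
      have *: "(m * l - l) / m / 2 + x * l / x / 2 = (1 - 1 / (2 * m)) * l" if "m > 0" "x > 0" for m x :: real
        using that by (simp add: field_simps)
      show ?thesis by (rule *) (use m Km in linarith)+
    qed
    finally show ?thesis .
  qed
  have "lipschitz ?R ((1 - (1 / (2 * ?m^2)) / (2 * real K)) * l) (push (push f))"
  proof (rule push_lipschitz_gain[OF preserved_differ_at[OF ab(1,2)] push_abs_le[OF f] lip' l])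
    show "\<bar>push f (1, w, G) - push f (1, w, G')\<bar> \<le> ?D w" if "w \<in> B 1" "(G, G') \<in> ?R" for w G G'
      using at_a[OF that(2)] lipschitzD[OF lip' one_in that] by simp
    have "1 / (2 * ?m) \<le> 1" using m by simp
    then show "0 \<le> ?D w" for w using l by simp
    show "(\<Sum>w\<in>B 1. ?D w) / ?m \<le> (1 - 1 / (2 * ?m^2)) * l"
    proof -
      have *: "(m * l - (l - (1 - 1 / (2 * m)) * l)) / m = (1 - 1 / (2 * m^2)) * l" if "m > 0" for m :: real
        using that by (simp add: field_simps power2_eq_square)
      have "(\<Sum>w\<in>B 1. ?D w) / ?m = (1 - 1 / (2 * ?m^2)) * l"
        by (subst sum_one_changed[OF finite_block ab(1)], rule *) (use m in linarith)
      then show ?thesis by simp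
    qed
  qed simp
  then show ?thesis by (simp add: mult_ac)
qed

text \<open>Here the gain comes from a crossing: from any vertex of \<open>B 1\<close> the second
  step selects community \<open>j\<close> with probability \<open>1 / (2 * (K - 1))\<close> and then
  merges the copies with probability at least \<open>1 / card (X 1 j)\<close>. The first step, which
  brings the walker into community 1, costs another factor \<open>1 / (2 * K)\<close>.\<close>

lemma two_steps_one_swap:
  assumes j: "j \<in> {1..K}" "1 \<noteq> j" and card: "card (X 1 j) \<ge> 3" and f: "\<And>s. \<bar>f s\<bar> \<le> c"
    and lip: "lipschitz (one_swap (X 1 j)) l f" and l: "0 \<le> l"
  shows "lipschitz (one_swap (X 1 j)) ((1 - 1 / (4 * real K^2 * real (card (X 1 j)))) * l) (push (push f))"
proof -
  let ?R = "one_swap (X 1 j)" and ?M = "real (card (X 1 j))"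
  note pres = preserved_one_swap[OF j(2) card]
  have Km: "real (K - 1) > 0" using K by simp
  have m: "real (card (B 1)) \<ge> 1" using card_block_pos[OF one_in] by linarith
  have M: "?M \<ge> 3" using card by simp
  have lip': "lipschitz ?R l (push f)"
    by (rule push_lipschitz_preserved[OF pres f lip l])
  have le1: "1 / (2 * real K * ?M) \<le> 1"
  proof -
    have "1 * 1 \<le> (2 * real K) * ?M" using M K by (intro mult_mono) auto
    then show ?thesis by (intro one_divide_le_one) simp
  qed
  have at: "\<bar>push f (1, w, G) - push f (1, w, G')\<bar> \<le> (1 - 1 / (2 * real K * ?M)) * l"
    if "w \<in> B 1" "(G, G') \<in> ?R" for w G G'
  proof -
    have "\<bar>push f (1, w, G) - push f (1, w, G')\<bar> \<le>
       (\<Sum>v\<in>B 1. 1 * l) / real (card (B 1)) / 2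
     + (\<Sum>k\<in>{1..K} - {1}. (if k = j then 1 - 1 / ?M else 1) * ((\<Sum>w\<in>B k. l) / real (card (B k)))) / real (K - 1) / 2"
    proof (rule push_lipschitz[OF f one_in _ _ _ _ that(2)])
      fix v assume "v \<in> B 1"
      then show "contracts ?R (refresh q w v) 1"
        using that(1) by (intro preservedD[OF pres one_in])
    next
      fix k assume "k \<in> {1..K}" "k \<noteq> 1"
      then show "contracts ?R (swap_in (X 1 k)) (if k = j then 1 - 1 / ?M else 1)"
        using swap_in_one_swap[of "X 1 j"] card preservedD(2)[OF pres one_in] by auto
    qed (use l lipschitzD[OF lip] in auto)
    also have "(\<Sum>v\<in>B 1. 1 * l) = real (card (B 1)) * l" by simp
    also have "(\<Sum>k\<in>{1..K} - {1}. (if k = j then 1 - 1 / ?M else 1) * ((\<Sum>w\<in>B k. l) / real (card (B k))))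
       = (\<Sum>k\<in>{1..K} - {1}. if k = j then (1 - 1 / ?M) * l else l)"
      using blocks by (intro sum.cong) auto
    also have "\<dots> = real (K - 1) * l - l / ?M"
      using j K by (subst sum_one_changed) (auto simp: algebra_simps)
    also have "real (card (B 1)) * l / real (card (B 1)) / 2 + (real (K - 1) * l - l / ?M) / real (K - 1) / 2
        = l - l / (2 * real (K - 1) * ?M)"
    proof -
      have *: "m * l / m / 2 + (x * l - l / y) / x / 2 = l - l / (2 * x * y)" if "m > 0" "x > 0" "y > 0" for m x y :: real
        using that by (simp add: field_simps)
      show ?thesis by (rule *) (use M m Km in linarith)+
    qed
    also have "\<dots> \<le> l - l / (2 * real K * ?M)"
      using K M l by (intro diff_left_mono divide_left_mono mult_right_mono mult_pos_pos) auto
    finally show ?thesis by (simp add: field_simps)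
  qed
  have "lipschitz ?R ((1 - (1 / (2 * real K * ?M)) / (2 * real K)) * l) (push (push f))"
  proof (rule push_lipschitz_gain[OF pres push_abs_le[OF f] lip' l at])
    show "0 \<le> (1 - 1 / (2 * real K * ?M)) * l" using le1 l by simp
  qed (use m in auto)
  then show ?thesis by (simp add: mult_ac power2_eq_square)
qed

text \<open>A relabelling inside \<open>B 1\<close> affects only pairs that meet \<open>B 1\<close>
  and preserves the number of edges between \<open>B 1\<close> and every other community; these
  relations suffice to connect two graphs that differ in this way.\<close>

definition moves :: "(graph \<times> graph) set set" where
  "moves = {differ_at {a, b} | a b. a \<in> B 1 \<and> b \<in> B 1 \<and> a \<noteq> b} \<union>
           {one_swap (X 1 j) | j. j \<in> {1..K} \<and> 1 \<noteq> j}"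

lemma lipschitz_mono: "lipschitz R l f \<Longrightarrow> l \<le> l' \<Longrightarrow> lipschitz R l' f"
  unfolding lipschitz_def by (fastforce intro: order_trans)

lemma card_cross_ge:
  assumes "j \<in> {1..K}" "1 \<noteq> j" shows "card (B 1) \<le> card (X 1 j)"
proof -
  obtain v where v: "v \<in> B j" using blocks[OF assms(1)] by blast
  then have "inj_on (\<lambda>u. {u, v}) (B 1)"
    by (auto simp: inj_on_def doubleton_eq_iff)
  moreover have "(\<lambda>u. {u, v}) ` B 1 \<subseteq> X 1 j" using v by (auto simp: cross_pairs_def)
  ultimately show ?thesis by (metis card_image card_mono finite_cross)
qed

lemma card_cross_le: "card (X i j) \<le> card (B i) * card (B j)"
proof -
  have "X i j = (\<lambda>(u, v). {u, v}) ` (B i \<times> B j)" by (auto simp: cross_pairs_def)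
  then show ?thesis using card_image_le[of "B i \<times> B j"] by (simp add: card_cartesian_product)
qed

text \<open>Steps are taken two at a time, and a remaining odd step does not increase the Lipschitz
  constant. The single number \<open>M\<close> serves both kinds of moves: for \<open>j = 1\<close>
  it dominates the square of \<open>card (B 1)\<close>, for other \<open>j\<close> the size of
  \<open>X 1 j\<close>.\<close>

lemma push_iterates_contract:
  assumes R: "R \<in> moves" and three: "card (B 1) \<ge> 3"
    and M: "\<And>j. j \<in> {1..K} \<Longrightarrow> real (card (B 1)) * real (card (B j)) \<le> M"
    and f: "\<And>s. \<bar>f s\<bar> \<le> c" and lip: "lipschitz R l f" and l: "0 \<le> l"
  shows "lipschitz R ((1 - 1 / (4 * real K^2 * M)) ^ (t div 2) * l) ((push ^^ t) f)"
proof -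
  let ?\<rho> = "1 - 1 / (4 * real K^2 * M)"
  have M9: "M \<ge> 9"
  proof -
    have "real 3 * real 3 \<le> real (card (B 1)) * real (card (B 1))"
      using three by (intro mult_mono) auto
    then show ?thesis using M[OF one_in] by simp
  qed
  have K1: "real K \<le> real K^2" "real K \<ge> 1" using K by (auto simp: power2_eq_square)
  have rho: "0 \<le> ?\<rho>" 
  proof -
    have "1 \<le> 4 * real K^2" using K1 by linarith
    then have "1 * 1 \<le> (4 * real K^2) * M" using M9 by (intro mult_mono) auto
    then have "1 / (4 * real K^2 * M) \<le> 1" by (intro one_divide_le_one) simp
    then show ?thesis by simp
  qed
  have two: "lipschitz R (?\<rho> * l) (push (push f))"
    if f: "\<And>s. \<bar>f s\<bar> \<le> c" and lip: "lipschitz R l f" and l: "0 \<le> l" for f l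
    using R unfolding moves_def
  proof (elim UnE CollectE exE conjE)
    fix a b assume ab: "R = differ_at {a, b}" "a \<in> B 1" "b \<in> B 1" "a \<noteq> b"
    have "4 * real K * real (card (B 1))^2 \<le> 4 * real K^2 * M"
      using M[OF one_in] K1 by (intro mult_mono) (auto simp: power2_eq_square)
    then have "1 / (4 * real K^2 * M) \<le> 1 / (4 * real K * real (card (B 1))^2)"
      using K three M9 by (intro divide_left_mono mult_pos_pos zero_less_power) auto
    then show ?thesis
      unfolding ab(1) using lip l
      by (intro lipschitz_mono[OF two_steps_differ_at[OF ab(2-4) f _ l]] mult_right_mono) (auto simp: ab(1))
  next
    fix j assume j: "R = one_swap (X 1 j)" "j \<in> {1..K}" "1 \<noteq> j"
    have c: "3 \<le> card (X 1 j)" using card_cross_ge[OF j(2,3)] three by linarith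
    have "real (card (X 1 j)) \<le> real (card (B 1) * card (B j))"
      using card_cross_le[of 1 j] by (simp only: of_nat_le_iff)
    then have "real (card (X 1 j)) \<le> M" using M[OF j(2)] by simp
    then have "4 * real K^2 * real (card (X 1 j)) \<le> 4 * real K^2 * M"
      by (intro mult_left_mono) auto
    moreover have "0 < 4 * real K^2 * real (card (X 1 j))" using K c by simp
    ultimately have "1 / (4 * real K^2 * M) \<le> 1 / (4 * real K^2 * real (card (X 1 j)))"
      using M9 K c by (intro divide_left_mono mult_pos_pos) auto
    then show ?thesis
      unfolding j(1) using lip l
      by (intro lipschitz_mono[OF two_steps_one_swap[OF j(2,3) c f _ l]] mult_right_mono) (auto simp: j(1))
  qed
  have pres: "preserved R"
    using R unfolding moves_def
  proof (elim UnE CollectE exE conjE)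
    fix a b assume "R = differ_at {a, b}" "a \<in> B 1" "b \<in> B 1"
    then show ?thesis by (simp add: preserved_differ_at)
  next
    fix j assume j: "R = one_swap (X 1 j)" "j \<in> {1..K}" "1 \<noteq> j"
    show ?thesis unfolding j(1)
      using card_cross_ge[OF j(2,3)] three by (intro preserved_one_swap j(3)) linarith
  qed
  have "lipschitz R (?\<rho> ^ (t div 2) * l) ((push ^^ t) f)"
  proof (induction t rule: nat_less_induct)
    case (1 t)
    consider "t = 0" | "t = 1" | s where "t = Suc (Suc s)" by (metis One_nat_def old.nat.exhaust)
    then show ?case
    proof cases
      case 1 then show ?thesis using lip by simp
    next
      case 2 then show ?thesis using push_lipschitz_preserved[OF pres f lip l] by simp
    next
      case (3 s)
      have "lipschitz R (?\<rho> * (?\<rho> ^ (s div 2) * l)) (push (push ((push ^^ s) f)))"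
        using 1 3 rho l by (intro two funpow_push_abs_le f) auto
      then show ?thesis using 3 by (simp add: mult_ac)
    qed
  qed
  then show ?thesis .
qed

end

section \<open>Relabelling vertices\<close>

definition relabel :: "(nat \<Rightarrow> nat) \<Rightarrow> graph \<Rightarrow> graph" where
  "relabel \<sigma> G = (\<lambda>e. \<sigma> ` e) ` G"

lemma inj_relabel_edge: "inj \<sigma> \<Longrightarrow> inj (\<lambda>e :: nat set. \<sigma> ` e)"
  by (auto simp: inj_def inj_image_eq_iff)

lemma relabel_set_ops:
  assumes "inj \<sigma>"
  shows "relabel \<sigma> (A \<inter> C) = relabel \<sigma> A \<inter> relabel \<sigma> C"
    and "relabel \<sigma> (A - C) = relabel \<sigma> A - relabel \<sigma> C"
    and "relabel \<sigma> (insert e A) = insert (\<sigma> ` e) (relabel \<sigma> A)"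
    and "card (relabel \<sigma> A) = card A"
  using inj_relabel_edge[OF assms]
  by (auto simp: relabel_def image_Int image_set_diff card_image inj_on_subset)

lemma map_pmf_of_set_relabel:
  assumes "inj \<sigma>" "finite A" "A \<noteq> {}"
  shows "map_pmf (\<lambda>e. \<sigma> ` e) (pmf_of_set A) = pmf_of_set (relabel \<sigma> A)"
  unfolding relabel_def using assms inj_relabel_edge[OF assms(1)]
  by (intro map_pmf_of_set_inj) (auto intro: inj_on_subset)

lemma refresh_relabel:
  assumes "inj \<sigma>"
  shows "refresh q (\<sigma> u) (\<sigma> v) (relabel \<sigma> G) = map_pmf (relabel \<sigma>) (refresh q u v G)"
proof (cases "u = v")
  case True
  then show ?thesis by (simp add: refresh_def)
next
  case False
  then have "\<sigma> u \<noteq> \<sigma> v" using assms by (simp add: inj_eq)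
  with False show ?thesis
    by (auto simp: refresh_def map_pmf_comp relabel_set_ops[OF assms] relabel_def[of _ "{}"]
         intro!: map_pmf_cong)
qed

text \<open>Since \<open>X\<close> is invariant, \<sigma> maps the edges and non-edges of
  \<open>G\<close> in \<open>X\<close> bijectively to those of the relabelled graph and therefore
  carries uniform selections to uniform selections.\<close>

lemma swap_in_relabel:
  assumes \<sigma>: "inj \<sigma>" and X: "finite X" "relabel \<sigma> X = X"
  shows "swap_in X (relabel \<sigma> G) = map_pmf (relabel \<sigma>) (swap_in X G)"
proof -
  have E: "X \<inter> relabel \<sigma> G = relabel \<sigma> (X \<inter> G)" and F: "X - relabel \<sigma> G = relabel \<sigma> (X - G)"
    by (simp_all add: relabel_set_ops[OF \<sigma>] X)
  have empty: "relabel \<sigma> A = {} \<longleftrightarrow> A = {}" for A by (simp add: relabel_def)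
  show ?thesis
  proof (cases "X \<inter> G = {} \<or> X - G = {}")
    case True
    then show ?thesis unfolding swap_in_def E F empty by simp
  next
    case False
    have "map_pmf (relabel \<sigma>) (swap_in X G) = map_pmf (\<lambda>(e1, e2). insert (\<sigma> ` e2) (relabel \<sigma> G - {\<sigma> ` e1}))
       (pair_pmf (pmf_of_set (X \<inter> G)) (pmf_of_set (X - G)))"
      using False by (simp add: swap_in_def map_pmf_comp case_prod_unfold relabel_set_ops[OF \<sigma>] relabel_def[of _ "{}"])
    also have "\<dots> = map_pmf (\<lambda>(e1, e2). insert e2 (relabel \<sigma> G - {e1}))
       (map_pmf (\<lambda>(e1, e2). (\<sigma> ` e1, \<sigma> ` e2)) (pair_pmf (pmf_of_set (X \<inter> G)) (pmf_of_set (X - G))))"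
      by (simp add: map_pmf_comp case_prod_unfold)
    also have "map_pmf (\<lambda>(e1, e2). (\<sigma> ` e1, \<sigma> ` e2)) (pair_pmf (pmf_of_set (X \<inter> G)) (pmf_of_set (X - G)))
        = pair_pmf (pmf_of_set (X \<inter> relabel \<sigma> G)) (pmf_of_set (X - relabel \<sigma> G))"
      unfolding map_pair E F using False X(1) by (simp add: map_pmf_of_set_relabel[OF \<sigma>])
    also have "map_pmf (\<lambda>(e1, e2). insert e2 (relabel \<sigma> G - {e1})) \<dots> = swap_in X (relabel \<sigma> G)"
      using False unfolding swap_in_def E F empty by simp
    finally show ?thesis by simp
  qed
qed

section \<open>Equivariance of the walk under relabelling\<close>

context edgelighter
begin

definition relabel_state :: "(nat \<Rightarrow> nat) \<Rightarrow> walk_state \<Rightarrow> walk_state" where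
  "relabel_state \<sigma> = (\<lambda>(i, u, G). (i, \<sigma> u, relabel \<sigma> G))"

lemma relabel_cross_pairs:
  assumes "\<And>i. \<sigma> ` B i = B i"
  shows "relabel \<sigma> (X i j) = X i j"
proof -
  have X: "X i j = (\<lambda>(u, v). {u, v}) ` (B i \<times> B j)" for i j by (auto simp: cross_pairs_def)
  have "relabel \<sigma> (X i j) = (\<lambda>(u, v). {u, v}) ` ((\<sigma> ` B i) \<times> (\<sigma> ` B j))"
    unfolding X relabel_def image_paired_Times[symmetric] image_image by (intro image_cong) auto
  then show ?thesis unfolding X by (simp add: assms)
qed

text \<open>The law of a step treats the vertices of a block alike, and an injection that maps each
  block to itself keeps the uniform law on it. The label has to be in range because the rates are
  prescribed only there.\<close>

lemma walk_step_relabel: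
  assumes \<sigma>: "inj \<sigma>" and inv: "\<And>i. \<sigma> ` B i = B i" and i: "fst s \<in> {1..K}"
  shows "walk_step n K \<tau> q1 q2 (relabel_state \<sigma> s) = map_pmf (relabel_state \<sigma>) (walk_step n K \<tau> q1 q2 s)"
proof -
  obtain i u G where s: "s = (i, u, G)" by (cases s)
  have i: "i \<in> {1..K}" using i s by simp
  have unif: "pmf_of_set (B j) = map_pmf \<sigma> (pmf_of_set (B j))" if "j \<in> {1..K}" for j
  proof -
    have "map_pmf \<sigma> (pmf_of_set (B j)) = pmf_of_set (\<sigma> ` B j)"
      using blocks[OF that] \<sigma> by (intro map_pmf_of_set_inj) (auto intro: inj_on_subset)
    then show ?thesis by (simp add: inv)
  qed
  have "stay_step n \<tau> q1 q2 (i, \<sigma> u, relabel \<sigma> G) = map_pmf (relabel_state \<sigma>) (stay_step n \<tau> q1 q2 (i, u, G))"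
  proof -
    have "stay_step n \<tau> q1 q2 (i, \<sigma> u, relabel \<sigma> G) =
      bind_pmf (pmf_of_set (B i)) (\<lambda>v. map_pmf (\<lambda>G'. (i, \<sigma> v, G')) (refresh q (\<sigma> u) (\<sigma> v) (relabel \<sigma> G)))"
      unfolding stay_step_eq[OF i] by (subst unif[OF i]) (simp add: bind_map_pmf)
    then show ?thesis
      unfolding stay_step_eq[OF i] by (simp add: refresh_relabel[OF \<sigma>] map_bind_pmf map_pmf_comp relabel_state_def)
  qed
  moreover have "leave_step n K \<tau> (i, \<sigma> u, relabel \<sigma> G) = map_pmf (relabel_state \<sigma>) (leave_step n K \<tau> (i, u, G))"
  proof -
    note ne = other_communities[of i]
    have "leave_step n K \<tau> (i, \<sigma> u, relabel \<sigma> G) = bind_pmf (pmf_of_set ({1..K} - {i})) (\<lambda>j.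
       bind_pmf (swap_in (X i j) (relabel \<sigma> G)) (\<lambda>G'. bind_pmf (pmf_of_set (B j)) (\<lambda>w. return_pmf (j, w, G'))))"
      by (simp add: leave_step_def swap_cross_eq)
    also have "\<dots> = bind_pmf (pmf_of_set ({1..K} - {i})) (\<lambda>j.
       bind_pmf (swap_in (X i j) (relabel \<sigma> G)) (\<lambda>G'. bind_pmf (map_pmf \<sigma> (pmf_of_set (B j))) (\<lambda>w. return_pmf (j, w, G'))))"
      using ne unif by (intro bind_pmf_cong refl) simp_all
    also have "\<dots> = map_pmf (relabel_state \<sigma>) (leave_step n K \<tau> (i, u, G))"
      by (simp add: leave_step_def swap_cross_eq map_bind_pmf bind_map_pmf relabel_state_def
            swap_in_relabel[OF \<sigma> finite_cross relabel_cross_pairs[OF inv]])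
    finally show ?thesis .
  qed
  ultimately show ?thesis
    unfolding s walk_step_def relabel_state_def
    by (auto simp: map_bind_pmf intro!: bind_pmf_cong split: if_splits)
qed

lemma fst_walk_step:
  assumes "fst s \<in> {1..K}" "s' \<in> set_pmf (walk_step n K \<tau> q1 q2 s)"
  shows "fst s' \<in> {1..K}"
proof -
  obtain i u G where s: "s = (i, u, G)" by (cases s)
  note ne = other_communities[of i]
  have i: "i \<in> {1..K}" using assms(1) s by simp
  have "fst s' = i" if "s' \<in> set_pmf (stay_step n \<tau> q1 q2 (i, u, G))"
    using that unfolding stay_step_eq[OF i] set_bind_pmf set_map_pmf by auto
  moreover have "fst s' \<in> {1..K} - {i}" if "s' \<in> set_pmf (leave_step n K \<tau> (i, u, G))"
  proof -
    have "set_pmf (pmf_of_set ({1..K} - {i})) = {1..K} - {i}" using ne by simp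
    then show ?thesis
      using that unfolding leave_step_def prod.case set_bind_pmf set_return_pmf UN_iff
      by (metis fst_conv singletonD)
  qed
  moreover have "s' \<in> set_pmf (stay_step n \<tau> q1 q2 s) \<or> s' \<in> set_pmf (leave_step n K \<tau> s)"
    using assms(2) unfolding walk_step_def set_bind_pmf by (auto split: if_splits)
  ultimately show ?thesis using i s by auto
qed

lemma fst_walk:
  assumes "fst s \<in> {1..K}" "s' \<in> set_pmf (walk n K \<tau> q1 q2 t s)"
  shows "fst s' \<in> {1..K}"
  using assms(2)
proof (induction t arbitrary: s')
  case 0
  then show ?case using assms(1) by simp
next
  case (Suc t)
  then obtain s'' where "s'' \<in> set_pmf (walk n K \<tau> q1 q2 t s)" "s' \<in> set_pmf (walk_step n K \<tau> q1 q2 s'')"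
    by auto
  then show ?case using Suc.IH fst_walk_step by blast
qed

lemma walk_relabel:
  assumes \<sigma>: "inj \<sigma>" and inv: "\<And>i. \<sigma> ` B i = B i" and i: "fst s \<in> {1..K}"
  shows "walk n K \<tau> q1 q2 t (relabel_state \<sigma> s) = map_pmf (relabel_state \<sigma>) (walk n K \<tau> q1 q2 t s)"
proof (induction t)
  case (Suc t)
  then show ?case
    by (auto simp: map_bind_pmf bind_map_pmf walk_step_relabel[OF \<sigma> inv fst_walk[OF i]] intro!: bind_pmf_cong)
qed simp

text \<open>Single flips inside community 1 and single swaps of cross pairs lead from \<open>G\<close> to \<open>G'\<close>, and
  each of them shrinks the symmetric difference.\<close>

lemma path_bound:
  fixes h :: "graph \<Rightarrow> real"
  assumes h: "\<And>R G G'. R \<in> moves \<Longrightarrow> (G, G') \<in> R \<Longrightarrow> \<bar>h G - h G'\<bar> \<le> l" and l: "0 \<le> l"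
    and fin: "finite (sym_diff G G')"
    and sub: "sym_diff G G' \<subseteq> {{a, b} | a b. a \<in> B 1 \<and> b \<in> B 1 \<and> a \<noteq> b} \<union> (\<Union>j\<in>{1..K} - {1}. X 1 j)"
    and card: "\<And>j. j \<in> {1..K} - {1} \<Longrightarrow> card (X 1 j \<inter> G) = card (X 1 j \<inter> G')"
  shows "\<bar>h G - h G'\<bar> \<le> real (card (sym_diff G G')) * l"
  using fin sub card
proof (induction "card (sym_diff G G')" arbitrary: G rule: less_induct)
  case less
  let ?D = "sym_diff G G'"
  \<comment> \<open>Any move from \<open>G\<close> that strictly shrinks the symmetric difference
    and keeps the cross edge counts closes the induction: it costs \<open>l\<close> and removes at
    least one pair.\<close>
  have step: ?case if R: "R \<in> moves" "(G, G1) \<in> R" and D1: "sym_diff G1 G' \<subset> ?D"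
    and c: "\<And>j. j \<in> {1..K} - {1} \<Longrightarrow> card (X 1 j \<inter> G1) = card (X 1 j \<inter> G)" for R G1
  proof -
    have lt: "card (sym_diff G1 G') < card ?D" by (rule psubset_card_mono[OF less.prems(1) D1])
    have "\<bar>h G1 - h G'\<bar> \<le> real (card (sym_diff G1 G')) * l"
    proof (rule less.hyps[OF lt])
      show "finite (sym_diff G1 G')" by (rule finite_subset[OF psubset_imp_subset[OF D1] less.prems(1)])
      show "sym_diff G1 G' \<subseteq> {{a, b} | a b. a \<in> B 1 \<and> b \<in> B 1 \<and> a \<noteq> b} \<union> (\<Union>j\<in>{1..K} - {1}. X 1 j)"
        by (rule order_trans[OF psubset_imp_subset[OF D1] less.prems(2)])
      show "card (X 1 j \<inter> G1) = card (X 1 j \<inter> G')" if "j \<in> {1..K} - {1}" for j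
        using c[OF that] less.prems(3)[OF that] by simp
    qed
    then have "\<bar>h G - h G'\<bar> \<le> l + real (card (sym_diff G1 G')) * l"
      using h[OF R] by linarith
    also have "\<dots> = (1 + real (card (sym_diff G1 G'))) * l" by (simp add: algebra_simps)
    also have "\<dots> \<le> real (card ?D) * l" using lt l by (intro mult_right_mono) linarith+
    finally show ?thesis .
  qed
  show ?case
  proof (cases "\<exists>a b. a \<in> B 1 \<and> b \<in> B 1 \<and> a \<noteq> b \<and> {a, b} \<in> ?D")
    case True
    then obtain a b where ab: "a \<in> B 1" "b \<in> B 1" "a \<noteq> b" "{a, b} \<in> ?D" by blast
    define e where "e = {a, b}"
    define G1 where "G1 = (if e \<in> G then G - {e} else insert e G)"
    show ?thesis
    proof (rule step)
      show "differ_at e \<in> moves" unfolding moves_def e_def using ab by blast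
      show "(G, G1) \<in> differ_at e" unfolding differ_at_def G1_def by auto
      show "sym_diff G1 G' \<subset> ?D"
      proof (rule psubsetI)
        show "sym_diff G1 G' \<subseteq> ?D" using ab(4) unfolding e_def[symmetric] G1_def by (auto split: if_splits)
        have "e \<notin> sym_diff G1 G'" using ab(4) unfolding e_def[symmetric] G1_def by (auto split: if_splits)
        then show "sym_diff G1 G' \<noteq> ?D" using ab(4) unfolding e_def[symmetric] by blast
      qed
      fix j assume "j \<in> {1..K} - {1}"
      then have "e \<notin> X 1 j" unfolding e_def using pair_notin_cross[OF ab(1,2), of 1 j] by simp
      then have "X 1 j \<inter> G1 = X 1 j \<inter> G" unfolding G1_def by auto
      then show "card (X 1 j \<inter> G1) = card (X 1 j \<inter> G)" by simp
    qed
  next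
    case noinner: False
    show ?thesis
    proof (cases "?D = {}")
      case True
      then have "G = G'" by blast
      then show ?thesis by simp
    next
      case False
      then obtain e where e: "e \<in> ?D" by blast
      then have "e \<in> {{a, b} | a b. a \<in> B 1 \<and> b \<in> B 1 \<and> a \<noteq> b} \<union> (\<Union>j\<in>{1..K} - {1}. X 1 j)"
        using less.prems(2) by (rule subsetD[rotated])
      moreover have "e \<notin> {{a, b} | a b. a \<in> B 1 \<and> b \<in> B 1 \<and> a \<noteq> b}" using noinner e by blast
      ultimately obtain j where j: "j \<in> {1..K} - {1}" "e \<in> X 1 j" by blast
      have neq: "X 1 j \<inter> G \<noteq> X 1 j \<inter> G'" using e j(2) by blast
      have ceq: "card (X 1 j \<inter> G) = card (X 1 j \<inter> G')" by (rule less.prems(3)[OF j(1)])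
      \<comment> \<open>The edge counts in the class agree while the edge sets differ, so neither
        contains the other: there is an edge \<open>x\<close> of \<open>G\<close> to give up and an
        edge \<open>y\<close> of \<open>G'\<close> to take in.\<close>
      have "\<not> X 1 j \<inter> G \<subseteq> X 1 j \<inter> G'" using card_subset_eq[OF _ _ ceq] neq by auto
      then obtain x where x: "x \<in> X 1 j" "x \<in> G" "x \<notin> G'" by blast
      have "\<not> X 1 j \<inter> G' \<subseteq> X 1 j \<inter> G" using card_subset_eq[OF _ _ ceq[symmetric]] neq by auto
      then obtain y where y: "y \<in> X 1 j" "y \<in> G'" "y \<notin> G" by blast
      define G1 where "G1 = insert y (G - {x})"
      show ?thesis
      proof (rule step)
        show "one_swap (X 1 j) \<in> moves" unfolding moves_def using j by blast
        show "(G, G1) \<in> one_swap (X 1 j)" unfolding one_swap_def G1_def using x y by blast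
        show "sym_diff G1 G' \<subset> ?D"
        proof (rule psubsetI)
          show "sym_diff G1 G' \<subseteq> ?D" unfolding G1_def using x y by blast
          have "x \<notin> sym_diff G1 G'" unfolding G1_def using x y by blast
          then show "sym_diff G1 G' \<noteq> ?D" using x by blast
        qed
        fix k assume k: "k \<in> {1..K} - {1}"
        show "card (X 1 k \<inter> G1) = card (X 1 k \<inter> G)"
        proof (cases "k = j")
          case True
          have "X 1 j \<inter> G1 = insert y ((X 1 j \<inter> G) - {x})" unfolding G1_def using x y by blast
          also have "card \<dots> = Suc (card ((X 1 j \<inter> G) - {x}))" using y by (intro card_insert_disjoint) auto
          also have "\<dots> = card (X 1 j \<inter> G)" using x by (intro card_Suc_Diff1) auto
          finally show ?thesis using True by simp
        next
          case False
          have "X 1 k \<inter> X 1 j = {}" using False k j by (intro cross_pairs_disjoint) (auto simp: doubleton_eq_iff)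
          then have "X 1 k \<inter> G1 = X 1 k \<inter> G" unfolding G1_def using x y by blast
          then show ?thesis by simp
        qed
      qed
    qed
  qed
qed

end

section \<open>Alignments of a relabelled graph\<close>

text \<open>The objective of the alignment problem as a sum over ordered pairs of vertices;
  \<open>trace_eq_overlap\<close> identifies it with the trace.\<close>

definition overlap :: "nat \<Rightarrow> graph \<Rightarrow> graph \<Rightarrow> (nat \<Rightarrow> nat) \<Rightarrow> real" where
  "overlap n G H \<pi> = (\<Sum>i<n. \<Sum>l<n. of_bool ({i, l} \<in> G) * of_bool ({\<pi> l, \<pi> i} \<in> H))"

lemma mat_mult_entry:
  assumes "i < dim_row A" "m < dim_col C" "dim_col A = n" "dim_row C = n"
  shows "(A * C) $$ (i, m) = (\<Sum>k<n. A $$ (i, k) * C $$ (k, m))"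
  using assms by (simp add: scalar_prod_def lessThan_atLeast0)

lemma trace_eq_overlap:
  assumes \<pi>: "\<pi> permutes {..<n}"
  shows "mat_trace (adj_mat n G * perm_mat n \<pi> * adj_mat n H * transpose_mat (perm_mat n \<pi>)) = overlap n G H \<pi>"
proof -
  have \<pi>n: "\<pi> i < n" if "i < n" for i using permutes_in_image[OF \<pi>, of i] that by simp
  let ?GP = "adj_mat n G * perm_mat n \<pi>"
  have dims: "dim_row (adj_mat n G) = n" "dim_col (adj_mat n G) = n" "dim_row (perm_mat n \<pi>) = n" "dim_col (perm_mat n \<pi>) = n"
    "dim_row (adj_mat n H) = n" "dim_col (adj_mat n H) = n"
    by (simp_all add: adj_mat_def perm_mat_def)
  have entryH: "adj_mat n H $$ (k, m) = of_bool ({k, m} \<in> H)" if "k < n" "m < n" for k m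
    using that by (simp add: adj_mat_def)
  have entryP: "perm_mat n \<pi> $$ (i, m) = of_bool (m = \<pi> i)" if "m < n" "i < n" for m i
    using that by (simp add: perm_mat_def)
  have 1: "?GP $$ (i, k) = (\<Sum>l<n. of_bool ({i, l} \<in> G) * of_bool (k = \<pi> l))" if "i < n" "k < n" for i k
    using that by (simp add: scalar_prod_def adj_mat_def perm_mat_def lessThan_atLeast0 of_bool_def)
  have 2: "(?GP * adj_mat n H) $$ (i, m) = (\<Sum>l<n. of_bool ({i, l} \<in> G) * of_bool ({\<pi> l, m} \<in> H))"
    if "i < n" "m < n" for i m
  proof -
    have "(?GP * adj_mat n H) $$ (i, m) = (\<Sum>k<n. ?GP $$ (i, k) * of_bool ({k, m} \<in> H))"
      using that by (subst mat_mult_entry[where n=n]) (simp_all add: dims entryH)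
    also have "\<dots> = (\<Sum>k<n. \<Sum>l<n. of_bool ({i, l} \<in> G) * of_bool (k = \<pi> l) * of_bool ({k, m} \<in> H))"
      using that by (intro sum.cong refl) (subst 1, auto simp: sum_distrib_right)
    also have "\<dots> = (\<Sum>l<n. \<Sum>k<n. of_bool ({i, l} \<in> G) * of_bool (k = \<pi> l) * of_bool ({k, m} \<in> H))"
      by (rule sum.swap)
    also have "\<dots> = (\<Sum>l<n. of_bool ({i, l} \<in> G) * of_bool ({\<pi> l, m} \<in> H))"
    proof (intro sum.cong refl)
      fix l assume "l \<in> {..<n}"
      have "(\<Sum>k<n. of_bool ({i, l} \<in> G) * of_bool (k = \<pi> l) * of_bool ({k, m} \<in> H) :: real)
          = (\<Sum>k<n. if k = \<pi> l then of_bool ({i, l} \<in> G) * of_bool ({k, m} \<in> H) else 0)"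
        by (intro sum.cong) auto
      also have "\<dots> = of_bool ({i, l} \<in> G) * of_bool ({\<pi> l, m} \<in> H)"
        using \<pi>n[of l] \<open>l \<in> {..<n}\<close> by (simp add: sum.delta)
      finally show "(\<Sum>k<n. of_bool ({i, l} \<in> G) * of_bool (k = \<pi> l) * of_bool ({k, m} \<in> H) :: real)
          = of_bool ({i, l} \<in> G) * of_bool ({\<pi> l, m} \<in> H)" .
    qed
    finally show ?thesis .
  qed
  have 3: "(?GP * adj_mat n H * transpose_mat (perm_mat n \<pi>)) $$ (i, i) = (\<Sum>l<n. of_bool ({i, l} \<in> G) * of_bool ({\<pi> l, \<pi> i} \<in> H))"
    if "i < n" for i
  proof -
    have "(?GP * adj_mat n H * transpose_mat (perm_mat n \<pi>)) $$ (i, i) = (\<Sum>m<n. (?GP * adj_mat n H) $$ (i, m) * of_bool (m = \<pi> i))"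
      using that by (subst mat_mult_entry[where n=n]) (simp_all add: dims entryP)
    also have "\<dots> = (\<Sum>m<n. if m = \<pi> i then (?GP * adj_mat n H) $$ (i, m) else 0)"
      by (intro sum.cong) auto
    also have "\<dots> = (?GP * adj_mat n H) $$ (i, \<pi> i)" using \<pi>n[OF that] by (simp add: sum.delta)
    also have "\<dots> = (\<Sum>l<n. of_bool ({i, l} \<in> G) * of_bool ({\<pi> l, \<pi> i} \<in> H))"
      by (rule 2[OF that \<pi>n[OF that]])
    finally show ?thesis .
  qed
  show ?thesis
    unfolding mat_trace_def overlap_def using 3 dims by (intro sum.cong) auto
qed

lemma perm_mat_in_best_alignments:
  assumes \<pi>: "\<pi> permutes {..<n}" and max: "\<And>\<rho>. \<rho> permutes {..<n} \<Longrightarrow> overlap n G H \<rho> \<le> overlap n G H \<pi>"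
  shows "perm_mat n \<pi> \<in> best_alignments n G H"
proof -
  have "perm_mat n \<pi> \<in> perm_mats n" using \<pi> by (auto simp: perm_mats_def)
  moreover have "\<not> overlap n G H \<pi> < mat_trace (adj_mat n G * P * adj_mat n H * transpose_mat P)" if P: "P \<in> perm_mats n" for P
  proof -
    obtain \<rho> where \<rho>: "P = perm_mat n \<rho>" "\<rho> permutes {..<n}" using P by (auto simp: perm_mats_def)
    show ?thesis unfolding \<rho>(1) trace_eq_overlap[OF \<rho>(2)] using max[OF \<rho>(2)] by simp
  qed
  ultimately show ?thesis
    unfolding best_alignments_def is_arg_max_def trace_eq_overlap[OF \<pi>, symmetric] by blast
qed

text \<open>Undoing the relabelling of \<open>H\<close> amounts to composing the alignment with the
  inverse of \<sigma>.\<close>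

lemma overlap_relabel:
  assumes \<sigma>: "bij \<sigma>"
  shows "overlap n G (relabel \<sigma> H) \<rho> = overlap n G H (inv_into UNIV \<sigma> \<circ> \<rho>)"
proof -
  have "{a, b} \<in> relabel \<sigma> H \<longleftrightarrow> {inv_into UNIV \<sigma> a, inv_into UNIV \<sigma> b} \<in> H" for a b
  proof -
    have "{a, b} = \<sigma> ` {inv_into UNIV \<sigma> a, inv_into UNIV \<sigma> b}" using \<sigma> by (simp add: bij_is_surj surj_f_inv_f)
    then show ?thesis
      using inj_image_mem_iff[OF inj_relabel_edge[OF bij_is_inj[OF \<sigma>]], of "{inv_into UNIV \<sigma> a, inv_into UNIV \<sigma> b}" H]
      by (simp add: relabel_def)
  qed
  then show ?thesis by (simp add: overlap_def)
qed

text \<open>Alignments are given as matrices, while shuffled vertices are counted on permutations;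
  uniqueness of the permutation lets the count be transferred between representations.\<close>

lemma perm_mat_inj:
  assumes "\<rho> permutes {..<n}" "\<rho>' permutes {..<n}" "perm_mat n \<rho> = perm_mat n \<rho>'"
  shows "\<rho> = \<rho>'"
proof
  fix u
  show "\<rho> u = \<rho>' u"
  proof (cases "u < n")
    case True
    then have "\<rho> u < n" using permutes_in_image[OF assms(1), of u] by simp
    then have "perm_mat n \<rho> $$ (u, \<rho> u) = 1" using True by (simp add: perm_mat_def)
    then have "perm_mat n \<rho>' $$ (u, \<rho> u) = 1" using assms(3) by simp
    then show ?thesis using True \<open>\<rho> u < n\<close> by (simp add: perm_mat_def split: if_splits)
  next
    case False
    then show ?thesis using assms(1,2) by (simp add: permutes_not_in)
  qed
qed

text \<open>One maximiser \<pi> for \<open>(G, H)\<close> is fixed before \<sigma> is chosen. Then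
  \<open>\<sigma> \<circ> \<pi>\<close> is a maximiser for \<open>(G, relabel \<sigma> H)\<close>,
  and the event, being a condition on all maximisers, applies to it in particular.\<close>

lemma aligned_relabelings_near:
  obtains \<pi> where "\<And>\<sigma>. \<sigma> permutes {..<n} \<Longrightarrow> (G, relabel \<sigma> H) \<in> align_event n \<tau> \<beta> \<Longrightarrow>
    real (card {v \<in> block n \<tau> 1. \<sigma> (\<pi> v) \<noteq> v}) \<le> real (card (block n \<tau> 1)) powr \<beta>"
proof -
  let ?F = "overlap n G H ` {\<pi>. \<pi> permutes {..<n}}"
  have "finite ?F" by (intro finite_imageI finite_permutations) simp
  moreover have "?F \<noteq> {}" using permutes_id by blast
  ultimately have "Max ?F \<in> ?F" by (rule Max_in)
  then obtain \<pi> where \<pi>: "\<pi> permutes {..<n}" "Max ?F = overlap n G H \<pi>" by blast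
  have max: "overlap n G H \<rho> \<le> overlap n G H \<pi>" if "\<rho> permutes {..<n}" for \<rho>
    unfolding \<pi>(2)[symmetric] using \<open>finite ?F\<close> that by (intro Max_ge) auto
  note \<pi> = \<pi>(1)
  show ?thesis
  proof (rule that)
    fix \<sigma> assume \<sigma>: "\<sigma> permutes {..<n}" and ev: "(G, relabel \<sigma> H) \<in> align_event n \<tau> \<beta>"
    have bij: "bij \<sigma>" by (rule permutes_bij[OF \<sigma>])
    have comp: "\<sigma> \<circ> \<pi> permutes {..<n}" by (rule permutes_compose[OF \<pi> \<sigma>])
    have "perm_mat n (\<sigma> \<circ> \<pi>) \<in> best_alignments n G (relabel \<sigma> H)"
    proof (rule perm_mat_in_best_alignments[OF comp])
      fix \<rho> assume \<rho>: "\<rho> permutes {..<n}"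
      have "inv_into UNIV \<sigma> \<circ> (\<sigma> \<circ> \<pi>) = \<pi>" using bij by (simp add: comp_assoc[symmetric] bij_is_inj)
      then show "overlap n G (relabel \<sigma> H) \<rho> \<le> overlap n G (relabel \<sigma> H) (\<sigma> \<circ> \<pi>)"
        unfolding overlap_relabel[OF bij] using max[OF permutes_compose[OF \<rho> permutes_inv[OF \<sigma>]]] by simp
    qed
    then have "perm_mat n (\<sigma> \<circ> \<pi>) \<in> perm_mats_shuffling n (block n \<tau> 1) \<beta>"
      using ev by (auto simp: align_event_def)
    then obtain \<rho> where \<rho>: "perm_mat n (\<sigma> \<circ> \<pi>) = perm_mat n \<rho>" "\<rho> permutes {..<n}"
      "real (card {v \<in> block n \<tau> 1. \<rho> v \<noteq> v}) \<le> real (card (block n \<tau> 1)) powr \<beta>"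
      by (auto simp: perm_mats_shuffling_def)
    have "\<rho> = \<sigma> \<circ> \<pi>" using perm_mat_inj[OF comp \<rho>(2,1)] by simp
    then show "real (card {v \<in> block n \<tau> 1. \<sigma> (\<pi> v) \<noteq> v}) \<le> real (card (block n \<tau> 1)) powr \<beta>"
      using \<rho>(3) by simp
  qed
qed

text \<open>A union bound over the exceptional sets \<open>T\<close> of size \<open>m\<close>. Two
  permutations of \<open>S\<close> that both send \<open>\<pi> v\<close> to \<open>v\<close> for all
  \<open>v\<close> in \<open>S - T\<close> differ by a permutation of \<open>T\<close>, so each
  \<open>T\<close> accounts for at most \<open>fact m\<close> of them. The product form avoids
  division of natural numbers, and \<pi> need not map \<open>S\<close> to itself.\<close>

lemma card_permutations_near:
  fixes S :: "'a set"
  assumes fin: "finite S" and m: "m \<le> card S"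
  shows "card {\<sigma>. \<sigma> permutes S \<and> card {v \<in> S. \<sigma> (\<pi> v) \<noteq> v} \<le> m} * fact (card S - m) \<le> fact (card S)"
proof -
  let ?Y = "\<lambda>T. {\<sigma>. \<sigma> permutes S \<and> (\<forall>v\<in>S - T. \<sigma> (\<pi> v) = v)}"
  let ?T = "{T. T \<subseteq> S \<and> card T = m}"
  have finp: "finite {\<sigma>. \<sigma> permutes S}" by (rule finite_permutations[OF fin])
  have finT: "finite ?T" by (rule finite_subset[of _ "Pow S"]) (use fin in auto)
  have Y: "card (?Y T) \<le> fact m" if T: "T \<in> ?T" for T
  proof (cases "?Y T = {}")
    case False
    then obtain \<sigma>0 where \<sigma>0: "\<sigma>0 permutes S" "\<forall>v\<in>S - T. \<sigma>0 (\<pi> v) = v" by blast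
    have finT: "finite T" using T fin finite_subset by blast
    have "(\<lambda>\<sigma>. \<sigma> \<circ> inv_into UNIV \<sigma>0) ` ?Y T \<subseteq> {\<rho>. \<rho> permutes T}"
    proof clarify
      fix \<sigma> assume \<sigma>: "\<sigma> permutes S" "\<forall>v\<in>S - T. \<sigma> (\<pi> v) = v"
      show "\<sigma> \<circ> inv_into UNIV \<sigma>0 permutes T"
      proof (rule permutes_superset[OF permutes_compose[OF permutes_inv[OF \<sigma>0(1)] \<sigma>(1)]])
        fix v assume v: "v \<in> S - T"
        then have "inv_into UNIV \<sigma>0 v = \<pi> v" using \<sigma>0 permutes_inverses(2)[OF \<sigma>0(1), of "\<pi> v"] by simp
        then show "(\<sigma> \<circ> inv_into UNIV \<sigma>0) v = v" using \<sigma>(2) v by simp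
      qed
    qed
    moreover have "inj_on (\<lambda>\<sigma>. \<sigma> \<circ> inv_into UNIV \<sigma>0) (?Y T)"
    proof (rule inj_onI)
      fix \<sigma> \<sigma>' assume "\<sigma> \<circ> inv_into UNIV \<sigma>0 = \<sigma>' \<circ> inv_into UNIV \<sigma>0"
      then have "\<sigma> \<circ> (inv_into UNIV \<sigma>0 \<circ> \<sigma>0) = \<sigma>' \<circ> (inv_into UNIV \<sigma>0 \<circ> \<sigma>0)" by (simp only: comp_assoc[symmetric])
      then show "\<sigma> = \<sigma>'" using permutes_inj[OF \<sigma>0(1)] by simp
    qed
    ultimately have "card (?Y T) \<le> card {\<rho>. \<rho> permutes T}"
      by (intro card_inj_on_le[where f="\<lambda>\<sigma>. \<sigma> \<circ> inv_into UNIV \<sigma>0"] finite_permutations finT)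
    also have "\<dots> = fact m" using T finT by (intro card_permutations) auto
    finally show ?thesis .
  next
    case True
    then show ?thesis by (simp only: card.empty)
  qed
  have "{\<sigma>. \<sigma> permutes S \<and> card {v \<in> S. \<sigma> (\<pi> v) \<noteq> v} \<le> m} \<subseteq> (\<Union>T\<in>?T. ?Y T)"
  proof
    fix \<sigma> assume "\<sigma> \<in> {\<sigma>. \<sigma> permutes S \<and> card {v \<in> S. \<sigma> (\<pi> v) \<noteq> v} \<le> m}"
    then have \<sigma>: "\<sigma> permutes S" "card {v \<in> S. \<sigma> (\<pi> v) \<noteq> v} \<le> m" by auto
    obtain T where T: "{v \<in> S. \<sigma> (\<pi> v) \<noteq> v} \<subseteq> T" "T \<subseteq> S" "card T = m"
      using exists_subset_between[OF \<sigma>(2) m] fin by auto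
    then show "\<sigma> \<in> (\<Union>T\<in>?T. ?Y T)" using \<sigma>(1) by blast
  qed
  then have "card {\<sigma>. \<sigma> permutes S \<and> card {v \<in> S. \<sigma> (\<pi> v) \<noteq> v} \<le> m} \<le> card (\<Union>T\<in>?T. ?Y T)"
    by (intro card_mono) (use finT finp in \<open>auto intro: finite_subset[OF _ finp]\<close>)
  also have "\<dots> \<le> (\<Sum>T\<in>?T. card (?Y T))" by (rule card_UN_le[OF finT])
  also have "\<dots> \<le> (\<Sum>T\<in>?T. fact m)" by (rule sum_mono[OF Y])
  also have "\<dots> = (card S choose m) * fact m" using n_subsets[OF fin, of m] by simp
  finally have "card {\<sigma>. \<sigma> permutes S \<and> card {v \<in> S. \<sigma> (\<pi> v) \<noteq> v} \<le> m} * fact (card S - m)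
     \<le> (card S choose m) * fact m * fact (card S - m)" by (rule mult_le_mono1)
  also have "\<dots> = fact (card S)" using binomial_fact_lemma[OF m] by (simp add: mult_ac)
  finally show ?thesis .
qed

section \<open>Bounding the alignment probability\<close>

lemma expec_le:
  assumes "\<And>x. x \<in> set_pmf p \<Longrightarrow> f x \<le> c" "\<And>x. \<bar>f x\<bar> \<le> B"
  shows "expec p f \<le> c"
proof -
  have "expec p f \<le> expec p (\<lambda>_. c)"
    using assms by (intro integral_mono_AE) (auto simp: AE_measure_pmf_iff intro: integrable_pmf_bounded[where B=B])
  then show ?thesis by simp
qed

lemma set_pmf_sbm: "G \<in> set_pmf (sbm n \<Lambda> \<tau>) \<Longrightarrow> G \<subseteq> vpairs n"
  by (auto simp: sbm_def)

lemma vpairs_subset: "vpairs n \<subseteq> (\<lambda>(u, v). {u, v}) ` ({..<n} \<times> {..<n})"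
  by (auto simp: vpairs_def)

lemma finite_vpairs: "finite (vpairs n)"
  by (rule finite_subset[OF vpairs_subset]) simp

lemma card_vpairs_le: "card (vpairs n) \<le> n^2"
proof -
  have "card (vpairs n) \<le> card ((\<lambda>(u, v). {u, v}) ` ({..<n} \<times> {..<n}))"
    by (rule card_mono[OF _ vpairs_subset]) simp
  also have "\<dots> \<le> card ({..<n} \<times> {..<n})" by (rule card_image_le) simp
  finally show ?thesis by (simp add: card_cartesian_product power2_eq_square)
qed

lemma relabel_vpairs:
  assumes \<sigma>: "\<sigma> permutes {..<n}" and G: "G \<subseteq> vpairs n"
  shows "relabel \<sigma> G \<subseteq> vpairs n"
proof
  fix e assume "e \<in> relabel \<sigma> G"
  then obtain e' where "e' \<in> G" "e = \<sigma> ` e'" by (auto simp: relabel_def)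
  moreover from this obtain u v where uv: "e' = {u, v}" "u < n" "v < n" "u \<noteq> v"
    using G by (auto simp: vpairs_def)
  ultimately have "e = {\<sigma> u, \<sigma> v}" by simp
  moreover have "\<sigma> u < n" "\<sigma> v < n" using permutes_in_image[OF \<sigma>] uv by simp_all
  moreover have "\<sigma> u \<noteq> \<sigma> v" using permutes_inj[OF \<sigma>] uv(4) by (simp add: inj_eq)
  ultimately show "e \<in> vpairs n" by (auto simp: vpairs_def)
qed

section \<open>Averaging over relabellings of community 1\<close>

context edgelighter
begin

lemma relabel_block:
  assumes \<sigma>: "\<sigma> permutes S" and S: "S \<subseteq> B 1"
  shows "\<sigma> ` B i = B i"
proof (cases "i = 1")
  case True
  then show ?thesis using permutes_image[OF permutes_subset[OF \<sigma> S]] by simp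
next
  case False
  then have "\<sigma> x = x" if "x \<in> B i" for x
    using that S by (intro permutes_not_in[OF \<sigma>]) (auto simp: block_def)
  then show ?thesis by (simp add: image_cong)
qed

text \<open>A pair disjoint from \<open>S\<close> is fixed by \<sigma> and has the same status in
  both graphs. Every differing pair thus has an endpoint in \<open>S\<close>, and the label of its
  other endpoint decides which kind of move can repair it.\<close>

lemma sym_diff_relabel:
  assumes \<sigma>: "\<sigma> permutes S" and S: "S \<subseteq> B 1" and G: "G \<subseteq> vpairs n"
  shows "sym_diff G (relabel \<sigma> G) \<subseteq> {{a, b} | a b. a \<in> B 1 \<and> b \<in> B 1 \<and> a \<noteq> b} \<union> (\<Union>j\<in>{1..K} - {1}. X 1 j)"
proof
  fix e assume e: "e \<in> sym_diff G (relabel \<sigma> G)"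
  have "S \<subseteq> {..<n}" using S by (auto simp: block_def)
  then have V: "e \<in> vpairs n" using e G relabel_vpairs[OF permutes_subset[OF \<sigma>] G] by blast
  have fix_e: "\<sigma> ` e' = e'" if "e' \<inter> S = {}" for e'
  proof -
    have "\<sigma> ` e' = (\<lambda>x. x) ` e'" using that by (intro image_cong refl permutes_not_in[OF \<sigma>]) auto
    then show ?thesis by simp
  qed
  have "e \<inter> S \<noteq> {}"
  proof
    assume eS: "e \<inter> S = {}"
    have "e \<in> G \<longleftrightarrow> e \<in> relabel \<sigma> G"
    proof -
      have "e \<in> relabel \<sigma> G \<longleftrightarrow> \<sigma> ` e \<in> (\<lambda>e. \<sigma> ` e) ` G" by (simp add: relabel_def fix_e[OF eS])
      also have "\<dots> \<longleftrightarrow> e \<in> G"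
        by (rule inj_image_mem_iff[OF inj_relabel_edge[OF permutes_inj[OF \<sigma>]]])
      finally show ?thesis by simp
    qed
    then show False using e by blast
  qed
  then obtain a where a: "a \<in> e" "a \<in> S" by blast
  from V obtain b where b: "e = {a, b}" "b < n" "a \<noteq> b"
    using a(1) unfolding vpairs_def by (auto simp: insert_commute)
  have a1: "a \<in> B 1" using a(2) S by blast
  show "e \<in> {{a, b} | a b. a \<in> B 1 \<and> b \<in> B 1 \<and> a \<noteq> b} \<union> (\<Union>j\<in>{1..K} - {1}. X 1 j)"
  proof (cases "\<tau> b = 1")
    case True
    then have "b \<in> B 1" using b by (simp add: block_def)
    then show ?thesis using a1 b by blast
  next
    case False
    have "b \<in> B (\<tau> b)" using b by (simp add: block_def)
    then have "e \<in> X 1 (\<tau> b)" unfolding b(1) cross_pairs_def using a1 by blast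
    then show ?thesis using labels[OF b(2)] False by blast
  qed
qed

text \<open>The relabelling fixes \<open>u\<close>, so both walks start from the same position and
  only their graphs differ, by at most \<open>n^2\<close> elementary moves. Each move changes the
  expectation by at most the contracted Lipschitz constant, and equivariance turns the walk from the
  relabelled graph into the relabelled walk.\<close>

lemma expec_walk_relabel:
  assumes \<sigma>: "\<sigma> permutes B 1 - {u}" and u: "u < n" and G: "G \<subseteq> vpairs n"
    and three: "card (B 1) \<ge> 3"
    and M: "\<And>j. j \<in> {1..K} \<Longrightarrow> real (card (B 1)) * real (card (B j)) \<le> M"
    and f: "\<And>G. 0 \<le> f G" "\<And>G. f G \<le> 1"
  shows "expec (walk n K \<tau> q1 q2 t (\<tau> u, u, G)) (\<lambda>(i, v, G'). f G')
      \<le> expec (walk n K \<tau> q1 q2 t (\<tau> u, u, G)) (\<lambda>(i, v, G'). f (relabel \<sigma> G'))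
        + real n^2 * (1 - 1 / (4 * real K^2 * M)) ^ (t div 2)"
proof -
  let ?F = "\<lambda>(i, v, G'). f G'" and ?l = "(1 - 1 / (4 * real K^2 * M)) ^ (t div 2)"
  let ?h = "\<lambda>G. (push ^^ t) ?F (\<tau> u, u, G)" and ?G' = "relabel \<sigma> G"
  have F: "\<bar>?F s\<bar> \<le> 1" for s :: walk_state using f by (auto split: prod.split)
  have inj: "inj \<sigma>" by (rule permutes_inj[OF \<sigma>])
  have inv: "\<sigma> ` B i = B i" for i by (rule relabel_block[OF \<sigma>]) auto
  have \<tau>u: "\<tau> u \<in> {1..K}" "u \<in> B (\<tau> u)" using labels[OF u] u by (auto simp: block_def)
  have lip: "lipschitz R (?l * 1) ((push ^^ t) ?F)" if "R \<in> moves" for R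
  proof (rule push_iterates_contract[OF that three M F])
    show "lipschitz R 1 ?F" unfolding lipschitz_def
    proof (intro ballI, clarify)
      fix G G' :: graph show "\<bar>f G - f G'\<bar> \<le> 1" using f[of G] f[of G'] by linarith
    qed
  qed auto
  have l0: "0 \<le> ?l"
  proof -
    have "real 3 * real 3 \<le> real (card (B 1)) * real (card (B 1))"
      using three by (intro mult_mono) auto
    then have "9 \<le> M" using M[OF one_in] by simp
    moreover have "1 \<le> real K^2" using K by (intro one_le_power) simp
    ultimately have "1 * 1 \<le> (4 * real K^2) * M" by (intro mult_mono) auto
    then have "1 / (4 * real K^2 * M) \<le> 1" by (intro one_divide_le_one) simp
    then show ?thesis by simp
  qed
  have S: "B 1 - {u} \<subseteq> B 1" by blast
  then have Sn: "B 1 - {u} \<subseteq> {..<n}" by (auto simp: block_def)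
  have D: "sym_diff G ?G' \<subseteq> vpairs n"
    using G relabel_vpairs[OF permutes_subset[OF \<sigma> Sn] G] by blast
  have "\<bar>?h G - ?h ?G'\<bar> \<le> real (card (sym_diff G ?G')) * ?l"
  proof (rule path_bound[OF _ l0 finite_subset[OF D finite_vpairs] sym_diff_relabel[OF \<sigma> S G]])
    show "\<bar>?h G - ?h G'\<bar> \<le> ?l" if "R \<in> moves" "(G, G') \<in> R" for R G G'
      using lipschitzD[OF lip[OF that(1)] \<tau>u that(2)] by simp
    show "card (X 1 j \<inter> G) = card (X 1 j \<inter> ?G')" for j
    proof -
      have "X 1 j \<inter> ?G' = relabel \<sigma> (X 1 j \<inter> G)"
        unfolding relabel_set_ops(1)[OF inj] relabel_cross_pairs[OF inv] ..
      then show ?thesis by (simp only: relabel_set_ops(4)[OF inj])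
    qed
  qed
  also have "\<dots> \<le> real n^2 * ?l"
  proof -
    have "card (sym_diff G ?G') \<le> n^2"
      using card_mono[OF finite_vpairs D] card_vpairs_le by (rule order_trans)
    then have "real (card (sym_diff G ?G')) \<le> real (n^2)" by (simp only: of_nat_le_iff)
    then show ?thesis using l0 by (intro mult_right_mono) auto
  qed
  finally have "?h G \<le> ?h ?G' + real n^2 * ?l" by linarith
  moreover have "?h G = expec (walk n K \<tau> q1 q2 t (\<tau> u, u, G)) ?F"
    by (rule expec_walk[OF F, symmetric])
  moreover have "?h ?G' = expec (walk n K \<tau> q1 q2 t (\<tau> u, u, G)) (\<lambda>(i, v, G'). f (relabel \<sigma> G'))"
  proof -
    have "\<sigma> u = u" by (rule permutes_not_in[OF \<sigma>]) simp
    then have "(\<tau> u, u, ?G') = relabel_state \<sigma> (\<tau> u, u, G)" by (simp add: relabel_state_def)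
    then have "?h ?G' = expec (walk n K \<tau> q1 q2 t (relabel_state \<sigma> (\<tau> u, u, G))) ?F"
      by (simp only: expec_walk[OF F])
    also have "walk n K \<tau> q1 q2 t (relabel_state \<sigma> (\<tau> u, u, G)) = map_pmf (relabel_state \<sigma>) (walk n K \<tau> q1 q2 t (\<tau> u, u, G))"
      by (rule walk_relabel[OF inj inv]) (use \<tau>u in simp)
    finally show ?thesis by (simp add: relabel_state_def case_prod_unfold)
  qed
  ultimately show ?thesis by simp
qed

text \<open>The bound of \<open>expec_walk_relabel\<close> is averaged over all \<sigma> permuting
  \<open>S\<close>. For each final graph separately, few of its relabelled versions can satisfy the
  event, by the count of permutations close to a fixed map. The integer \<open>m\<close> bounds the
  number of shuffled vertices.\<close>

lemma align_prob_from_start: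
  assumes u: "u < n" and G: "G \<subseteq> vpairs n" and three: "card (B 1) \<ge> 3"
    and M: "\<And>j. j \<in> {1..K} \<Longrightarrow> real (card (B 1)) * real (card (B j)) \<le> M"
    and m: "real (card (B 1)) powr \<beta> < real (Suc m)" "m < card (B 1)"
  shows "expec (walk n K \<tau> q1 q2 t (\<tau> u, u, G)) (\<lambda>(i, v, G'). indicator (align_event n \<tau> \<beta>) (G, G'))
     \<le> 1 / fact (card (B 1) - 1 - m) + real n^2 * (1 - 1 / (4 * real K^2 * M)) ^ (t div 2)"
proof -
  define S where "S = B 1 - {u}"
  let ?W = "walk n K \<tau> q1 q2 t (\<tau> u, u, G)"
  let ?f = "\<lambda>G'. indicator (align_event n \<tau> \<beta>) (G, G') :: real"
  let ?\<epsilon> = "real n^2 * (1 - 1 / (4 * real K^2 * M)) ^ (t div 2)"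
  let ?P = "{\<sigma>. \<sigma> permutes S}"
  have finS: "finite S" by (simp add: S_def)
  have finP: "finite ?P" by (rule finite_permutations[OF finS])
  have cardP: "card ?P = fact (card S)" by (rule card_permutations[OF refl finS])
  \<comment> \<open>Equality holds when \<open>u\<close> lies in \<open>B 1\<close>, and otherwise
    \<open>S\<close> is all of \<open>B 1\<close>; the smaller size covers both cases.\<close>
  have S: "card (B 1) - 1 \<le> card S" unfolding S_def by (simp add: card_Diff_singleton_if)
  have Sn: "S \<subseteq> {..<n}" by (auto simp: block_def S_def)
  have count: "(\<Sum>\<sigma>\<in>?P. ?f (relabel \<sigma> G')) \<le> fact (card S) / fact (card S - m)" for G'
  proof -
    obtain \<pi> where \<pi>: "\<And>\<sigma>. \<sigma> permutes {..<n} \<Longrightarrow> (G, relabel \<sigma> G') \<in> align_event n \<tau> \<beta> \<Longrightarrow>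
      real (card {v \<in> B 1. \<sigma> (\<pi> v) \<noteq> v}) \<le> real (card (B 1)) powr \<beta>"
      using aligned_relabelings_near[of n G G' \<tau> \<beta>] by blast
    let ?N = "{\<sigma>. \<sigma> permutes S \<and> card {v \<in> S. \<sigma> (\<pi> v) \<noteq> v} \<le> m}"
    have near: "card {v \<in> S. \<sigma> (\<pi> v) \<noteq> v} \<le> m"
      if \<sigma>: "\<sigma> permutes S" and ev: "(G, relabel \<sigma> G') \<in> align_event n \<tau> \<beta>" for \<sigma>
    proof -
      have "card {v \<in> S. \<sigma> (\<pi> v) \<noteq> v} \<le> card {v \<in> B 1. \<sigma> (\<pi> v) \<noteq> v}"
        by (intro card_mono) (auto simp: S_def)
      moreover have "real (card {v \<in> B 1. \<sigma> (\<pi> v) \<noteq> v}) < real (Suc m)"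
        using \<pi>[OF permutes_subset[OF \<sigma> Sn] ev] m(1) by linarith
      ultimately show ?thesis by linarith
    qed
    have "(\<Sum>\<sigma>\<in>?P. ?f (relabel \<sigma> G')) \<le> (\<Sum>\<sigma>\<in>?P. if \<sigma> \<in> ?N then 1 else 0)"
    proof (rule sum_mono)
      fix \<sigma> assume "\<sigma> \<in> ?P"
      then show "?f (relabel \<sigma> G') \<le> (if \<sigma> \<in> ?N then 1 else 0)" using near[of \<sigma>] by (auto simp: indicator_def)
    qed
    also have "\<dots> = (\<Sum>\<sigma>\<in>?P \<inter> ?N. 1)" by (rule sum.inter_restrict[OF finP, symmetric])
    also have "?P \<inter> ?N = ?N" by blast
    also have "(\<Sum>\<sigma>\<in>?N. 1) = real (card ?N)" by simp
    also have "real (card ?N) \<le> fact (card S) / fact (card S - m)"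
    proof -
      have "card ?N * fact (card S - m) \<le> fact (card S)"
        using m(2) S by (intro card_permutations_near[OF finS]) linarith
      then have "real (card ?N * fact (card S - m)) \<le> real (fact (card S))" by (simp only: of_nat_le_iff)
      then show ?thesis by (simp add: field_simps)
    qed
    finally show ?thesis .
  qed
  have "fact (card S) * expec ?W (\<lambda>(i, v, G'). ?f G') = (\<Sum>\<sigma>\<in>?P. expec ?W (\<lambda>(i, v, G'). ?f G'))"
    using cardP by simp
  also have "\<dots> \<le> (\<Sum>\<sigma>\<in>?P. expec ?W (\<lambda>(i, v, G'). ?f (relabel \<sigma> G')) + ?\<epsilon>)"
    by (intro sum_mono expec_walk_relabel[OF _ u G three M]) (auto simp: S_def)
  also have "\<dots> = expec ?W (\<lambda>s. \<Sum>\<sigma>\<in>?P. case s of (i, v, G') \<Rightarrow> ?f (relabel \<sigma> G')) + fact (card S) * ?\<epsilon>"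
  proof -
    have "expec ?W (\<lambda>s. \<Sum>\<sigma>\<in>?P. case s of (i, v, G') \<Rightarrow> ?f (relabel \<sigma> G'))
       = (\<Sum>\<sigma>\<in>?P. expec ?W (\<lambda>s. case s of (i, v, G') \<Rightarrow> ?f (relabel \<sigma> G')))"
      by (rule Bochner_Integration.integral_sum) (auto intro!: integrable_pmf_bounded[where B=1] split: prod.split)
    then show ?thesis using cardP by (simp add: sum.distrib)
  qed
  also have "expec ?W (\<lambda>s. \<Sum>\<sigma>\<in>?P. case s of (i, v, G') \<Rightarrow> ?f (relabel \<sigma> G')) \<le> fact (card S) / fact (card S - m)"
  proof (rule expec_le)
    show "(\<Sum>\<sigma>\<in>?P. case s of (i, v, G') \<Rightarrow> ?f (relabel \<sigma> G')) \<le> fact (card S) / fact (card S - m)" for s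
      using count by (cases s) simp
    show "\<bar>\<Sum>\<sigma>\<in>?P. case s of (i, v, G') \<Rightarrow> ?f (relabel \<sigma> G')\<bar> \<le> (\<Sum>\<sigma>\<in>?P. 1)" for s
      by (rule order_trans[OF sum_abs sum_mono]) (auto split: prod.split simp: indicator_def)
  qed
  finally have "fact (card S) * expec ?W (\<lambda>(i, v, G'). ?f G') \<le> fact (card S) * (1 / fact (card S - m) + ?\<epsilon>)"
    by (simp add: field_simps)
  then have "expec ?W (\<lambda>(i, v, G'). ?f G') \<le> 1 / fact (card S - m) + ?\<epsilon>"
    by (simp only: mult_le_cancel_left_pos fact_gt_zero)
  moreover have "1 / fact (card S - m) \<le> (1 / fact (card (B 1) - 1 - m) :: real)"
    using S by (intro divide_left_mono fact_mono mult_pos_pos) auto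
  ultimately show ?thesis by linarith
qed

lemma align_prob:
  assumes \<mu>: "set_pmf \<mu> \<subseteq> {..<n}" and three: "card (B 1) \<ge> 3"
    and M: "\<And>j. j \<in> {1..K} \<Longrightarrow> real (card (B 1)) * real (card (B j)) \<le> M"
    and m: "real (card (B 1)) powr \<beta> < real (Suc m)" "m < card (B 1)"
  shows "measure_pmf.prob (walk_graphs n K \<Lambda> \<tau> q1 q2 \<mu> t) (align_event n \<tau> \<beta>)
     \<le> 1 / fact (card (B 1) - 1 - m) + real n^2 * (1 - 1 / (4 * real K^2 * M)) ^ (t div 2)"
    (is "_ \<le> ?c")
proof -
  let ?A = "align_event n \<tau> \<beta>"
  let ?w = "\<lambda>G0 u. expec (walk n K \<tau> q1 q2 t (\<tau> u, u, G0)) (\<lambda>(i, v, G). indicator ?A (G0, G))"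
  have ind: "\<bar>indicator ?A x\<bar> \<le> (1::real)" for x by (simp add: indicator_def)
  have w1: "\<bar>?w G0 u\<bar> \<le> 1" for G0 u by (rule expec_abs_le) (auto simp: indicator_def split: prod.split)
  have "measure_pmf.prob (walk_graphs n K \<Lambda> \<tau> q1 q2 \<mu> t) ?A = expec (walk_graphs n K \<Lambda> \<tau> q1 q2 \<mu> t) (indicator ?A)"
    by simp
  also have "\<dots> = expec (sbm n \<Lambda> \<tau>) (\<lambda>G0. expec \<mu> (\<lambda>u. ?w G0 u))"
  proof -
    have ret: "expec (return_pmf x) h = h x" for x :: "graph \<times> graph" and h by simp
    show ?thesis
      unfolding walk_graphs_def by (simp only: expec_bind[where B=1, OF ind] case_prod_unfold ret)
  qed
  also have "\<dots> \<le> ?c"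
  proof (rule expec_le)
    fix G0 assume "G0 \<in> set_pmf (sbm n \<Lambda> \<tau>)"
    then have G0: "G0 \<subseteq> vpairs n" by (rule set_pmf_sbm)
    show "expec \<mu> (?w G0) \<le> ?c"
    proof (rule expec_le[OF _ w1])
      fix u assume "u \<in> set_pmf \<mu>"
      then have "u < n" using \<mu> by blast
      then show "?w G0 u \<le> ?c" by (rule align_prob_from_start[OF _ G0 three M m])
    qed
  next
    show "\<bar>expec \<mu> (?w G0)\<bar> \<le> 1" for G0 by (rule expec_abs_le[OF w1])
  qed
  finally show ?thesis .
qed

end

section \<open>Explicit rate and asymptotics\<close>

lemma two_power_le_fact: "2 ^ k \<le> 2 * (fact k :: real)"
proof (induction k)
  case (Suc k)
  show ?case
  proof (cases "k = 0")
    case False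
    have "2 ^ Suc k \<le> 2 * (2 * (fact k :: real))" using Suc by simp
    also have "\<dots> \<le> real (Suc k) * (2 * fact k)" using False by (intro mult_right_mono) auto
    finally show ?thesis by (simp add: mult_ac)
  qed simp
qed simp

lemma rounds_bounds: "rounds m x \<Longrightarrow> real m \<le> x + 1 \<and> x - 1 \<le> real m"
proof -
  assume "rounds m x"
  then have "real_of_int (int m) = of_int \<lfloor>x\<rfloor> \<or> real_of_int (int m) = of_int \<lceil>x\<rceil>"
    unfolding rounds_def by presburger
  then have "real m = of_int \<lfloor>x\<rfloor> \<or> real m = of_int \<lceil>x\<rceil>" by (simp only: of_int_of_nat_eq)
  then show "real m \<le> x + 1 \<and> x - 1 \<le> real m" by linarith
qed

lemma one_minus_power_le_exp:
  fixes x :: real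
  assumes "0 \<le> x" "x \<le> 1"
  shows "(1 - x) ^ k \<le> exp (- (x * real k))"
proof -
  have "(1 - x) ^ k \<le> exp (- x) ^ k" using assms exp_ge_add_one_self[of "- x"] by (intro power_mono) auto
  then show ?thesis by (simp add: exp_of_nat_mult[symmetric] mult.commute)
qed

text \<open>An explicit bound for the right-hand side of \<open>align_prob\<close>. The first
  summand comes from the factorial when \<open>m\<close> is at most half of
  \<open>card (B 1)\<close>, the second from the contraction with
  \<open>M = (b1 * n powr a1 + 1) * (b2 * n + 1)\<close>. The terms \<open>1\<close> allow for
  rounding of block sizes, the subtracted \<open>2\<close> for rounding the time and halving
  it.\<close>

definition align_rate :: "nat \<Rightarrow> real \<Rightarrow> real \<Rightarrow> real \<Rightarrow> real \<Rightarrow> nat \<Rightarrow> real" where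
  "align_rate K a1 a2 b1 b2 n =
     4 * 2 powr (- ((b1 * real n powr a1 - 1) / 2))
   + real n ^ 2 * exp (- (((real n powr (1 + a2) * ln (real n) powr (3 / 2)) - 2) / 2
       / (4 * real K ^ 2 * ((b1 * real n powr a1 + 1) * (b2 * real n + 1)))))"

text \<open>The first summand decays exponentially in \<open>n powr a1\<close>. In the second, the
  exponent is of order \<open>n powr (a2 - a1)\<close> times \<open>ln n powr (3 / 2)\<close>, which
  outgrows any multiple of \<open>ln n\<close> because \<open>a1 < a2\<close>.\<close>

lemma align_rate_bigo:
  assumes "2 \<le> K" "b1 > 0" "b2 > 0" "0 < a1" "a1 < a2" "a2 < 1"
  shows "align_rate K a1 a2 b1 b2 \<in> O(\<lambda>n. real n powr ((a2 - 1) / 2))"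
proof -
  define k where "k = 4 * real K ^ 2"
  have k: "k > 0" using assms(1) by (simp add: k_def)
  have "(\<lambda>n. 4 * 2 powr (- ((b1 * real n powr a1 - 1) / 2))) \<in> O(\<lambda>n. real n powr ((a2 - 1) / 2))"
    using assms by real_asymp
  moreover have "(\<lambda>n. real n ^ 2 * exp (- (((real n powr (1 + a2) * ln (real n) powr (3 / 2)) - 2) / 2
       / (k * ((b1 * real n powr a1 + 1) * (b2 * real n + 1)))))) \<in> O(\<lambda>n. real n powr ((a2 - 1) / 2))"
    using assms k by real_asymp
  ultimately show ?thesis unfolding align_rate_def k_def by (rule sum_in_bigo)
qed

lemma (in edgelighter) align_prob_le_rate:
  assumes \<mu>: "set_pmf \<mu> \<subseteq> {..<n}"
    and n1: "card (B 1) \<ge> 6" "b1 * real n powr a1 - 1 \<le> card (B 1)" "card (B 1) \<le> b1 * real n powr a1 + 1"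
    and nmax: "\<And>j. j \<in> {1..K} \<Longrightarrow> card (B j) \<le> b2 * real n + 1"
    and \<beta>: "real (card (B 1)) powr \<beta> \<le> real (card (B 1)) / 2"
    and N: "N = nat \<lfloor>real n powr (1 + a2) * ln (real n) powr (3 / 2)\<rfloor>"
  shows "measure_pmf.prob (walk_graphs n K \<Lambda> \<tau> q1 q2 \<mu> N) (align_event n \<tau> \<beta>) \<le> align_rate K a1 a2 b1 b2 n"
proof -
  let ?n1 = "card (B 1)" and ?Y = "real n powr (1 + a2) * ln (real n) powr (3 / 2)"
  define M where "M = (b1 * real n powr a1 + 1) * (b2 * real n + 1)"
  define m where "m = nat \<lfloor>real ?n1 powr \<beta>\<rfloor>"
  have M: "real ?n1 * real (card (B j)) \<le> M" if "j \<in> {1..K}" for j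
    unfolding M_def using n1(3) nmax[OF that] by (intro mult_mono) auto
  have m1: "real ?n1 powr \<beta> < real (Suc m)" unfolding m_def by simp linarith
  have m2: "real m \<le> real ?n1 / 2" unfolding m_def using \<beta> powr_ge_zero[of "real ?n1" \<beta>] by linarith
  have "m < ?n1" using m2 n1(1) by linarith
  then have "measure_pmf.prob (walk_graphs n K \<Lambda> \<tau> q1 q2 \<mu> N) (align_event n \<tau> \<beta>)
     \<le> 1 / fact (?n1 - 1 - m) + real n^2 * (1 - 1 / (4 * real K^2 * M)) ^ (N div 2)"
    using n1(1) by (intro align_prob \<mu> M m1) auto
  also have "\<dots> \<le> 4 * 2 powr (- ((b1 * real n powr a1 - 1) / 2))
      + real n ^ 2 * exp (- ((?Y - 2) / 2 / (4 * real K ^ 2 * M)))"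
  proof (intro add_mono mult_left_mono)
    let ?k = "?n1 - 1 - m"
    \<comment> \<open>The factor 4 obtained below has two sources: one factor 2 compensates the
      \<open>- 1\<close> in this exponent, the other comes from
      \<open>two_power_le_fact\<close>.\<close>
    have "real ?k \<ge> real ?n1 / 2 - 1" using m2 n1(1) \<open>m < ?n1\<close> by linarith
    then have "(b1 * real n powr a1 - 1) / 2 - 1 \<le> real ?k"
      using divide_right_mono[OF n1(2), of 2] by linarith
    then have "2 powr ((b1 * real n powr a1 - 1) / 2 - 1) \<le> 2 powr real ?k" by simp
    also have "\<dots> \<le> 2 * fact ?k" using two_power_le_fact[of ?k] by (simp add: powr_realpow)
    finally have "2 powr ((b1 * real n powr a1 - 1) / 2) \<le> 4 * fact ?k" by (simp add: powr_diff)
    then show "1 / fact ?k \<le> 4 * 2 powr (- ((b1 * real n powr a1 - 1) / 2))"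
      by (simp add: powr_minus field_simps)
    have "real 6 * real 6 \<le> real ?n1 * real ?n1" using n1(1) by (intro mult_mono) auto
    then have M1: "1 \<le> M" using M[OF one_in] by simp
    have "1 \<le> real K^2" using K by (intro one_le_power) simp
    then have k1: "1 \<le> 4 * real K^2" by linarith
    then have "1 * 1 \<le> (4 * real K^2) * M" using M1 by (intro mult_mono) auto
    then have D: "1 \<le> 4 * real K^2 * M" by simp
    have "(1 - 1 / (4 * real K^2 * M)) ^ (N div 2) \<le> exp (- (1 / (4 * real K^2 * M) * real (N div 2)))"
    proof (rule one_minus_power_le_exp)
      show "0 \<le> 1 / (4 * real K^2 * M)" using D by (intro divide_nonneg_nonneg) linarith+
    qed (rule one_divide_le_one[OF D])
    also have "\<dots> \<le> exp (- ((?Y - 2) / 2 / (4 * real K ^ 2 * M)))"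
    proof -
      \<comment> \<open>Taking the integer part loses at most 1 and halving an odd \<open>N\<close>
        at most another 1, which gives the \<open>2\<close> subtracted in
        \<open>align_rate\<close>.\<close>
      have "?Y - 1 \<le> real N" unfolding N by linarith
      moreover have "real N - 1 \<le> 2 * real (N div 2)"
      proof -
        have "N \<le> 2 * (N div 2) + 1" by presburger
        then show ?thesis by linarith
      qed
      moreover have "(y - 2) / 2 \<le> c" if "y - 1 \<le> a" "a - 1 \<le> 2 * c" for y a c :: real
        using that by (simp add: divide_le_eq)
      ultimately have "(?Y - 2) / 2 \<le> real (N div 2)" by blast
      then have "(?Y - 2) / 2 / (4 * real K ^ 2 * M) \<le> real (N div 2) / (4 * real K ^ 2 * M)"
        using D by (intro divide_right_mono) (assumption | linarith)+
      then show ?thesis by simp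
    qed
    finally show "(1 - 1 / (4 * real K^2 * M)) ^ (N div 2) \<le> exp (- ((?Y - 2) / 2 / (4 * real K ^ 2 * M)))" .
  qed simp
  finally show ?thesis unfolding align_rate_def M_def .
qed

theorem theorem3:
  fixes K :: nat
    and \<Lambda> :: "nat \<Rightarrow> nat \<Rightarrow> nat \<Rightarrow> real"
    and \<tau> :: "nat \<Rightarrow> nat \<Rightarrow> nat"
    and \<mu> :: "nat \<Rightarrow> nat pmf"
    and q1 q2 :: "nat \<Rightarrow> real"
    and a1 a2 b1 b2 b3 q \<beta> :: real
  assumes K: "K \<ge> 2"
    and labels: "\<And>n v. v < n \<Longrightarrow> \<tau> n v \<in> {1..K}"
    and smallest: "\<And>n. bsize n (\<tau> n) 1 = Min (bsize n (\<tau> n) ` {1..K})"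
    and \<Lambda>_range: "\<And>n i j. i \<in> {1..K} \<Longrightarrow> j \<in> {1..K} \<Longrightarrow> \<Lambda> n i j \<in> {0..1}"
    and \<Lambda>_sym: "\<And>n i j. i \<in> {1..K} \<Longrightarrow> j \<in> {1..K} \<Longrightarrow> \<Lambda> n i j = \<Lambda> n j i"
    and start: "\<And>n. n > 0 \<Longrightarrow> set_pmf (\<mu> n) \<subseteq> {..<n}"
    and b: "b1 > 0" "b2 > 0" "b3 > 0"
    and a: "0 < a1" "a1 < a2" "a2 < 1"
    and size_1: "eventually (\<lambda>n. rounds (bsize n (\<tau> n) 1) (b1 * real n powr a1)) sequentially"
    and size_max: "eventually (\<lambda>n. rounds (Max (bsize n (\<tau> n) ` {1..K})) (b2 * real n)) sequentially"
    and \<Lambda>_upper: "eventually (\<lambda>n. \<forall>j\<in>{1..K} - {1}.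
          \<Lambda> n 1 j \<le> b3 * (real n powr a2 / (real (bsize n (\<tau> n) j) * real (bsize n (\<tau> n) 1)))) sequentially"
    and \<Lambda>_lower_cross: "eventually (\<lambda>n. \<forall>i\<in>{1..K}. \<forall>j\<in>{1..K}. i \<noteq> j \<longrightarrow>
          \<Lambda> n i j \<ge> 5 * (ln (real n) / (real (bsize n (\<tau> n) i) * real (bsize n (\<tau> n) j)))) sequentially"
    and \<Lambda>_lower_within: "eventually (\<lambda>n. \<forall>i\<in>{1..K}.
          \<Lambda> n i i \<ge> 5 * (ln (real n) / real (bsize n (\<tau> n) i choose 2))) sequentially"
    and q: "0 < q" "q < 1"
    and rates: "\<And>i. i \<in> {1..K} \<Longrightarrow> 1 - q1 i = q \<and> q2 i = q"
    and \<beta>: "0 < \<beta>" "\<beta> < 1"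
  shows "\<exists>C>0.
    \<exists>r1 \<in> O(\<lambda>n. (2 * real (bsize n (\<tau> n) 1) powr \<beta>) powr
                  (- (real (bsize n (\<tau> n) 1) / (2 * real (bsize n (\<tau> n) 1) powr \<beta> + 1)))).
    \<exists>r2 \<in> O(\<lambda>n. (real (bsize n (\<tau> n) 1) * real (Max (bsize n (\<tau> n) ` {1..K}))) powr
                  (- (C * real n powr a2))).
    \<exists>r3 \<in> O(\<lambda>n. real n powr (2 * a2) * ln (real n) * real K powr (- (real n powr ((1 - a2) / 2)))).
    \<exists>r4 \<in> O(\<lambda>n. real n powr ((a2 - 1) / 2)).
    \<exists>s \<in> \<Omega>(\<lambda>n. real n powr a1 * ln (real n) powr (1 / 2)).
      (\<forall>n. s n \<ge> 0) \<and>
      eventually (\<lambda>n.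
        measure_pmf.prob
          (walk_graphs n K (\<Lambda> n) (\<tau> n) q1 q2 (\<mu> n) (nat \<lfloor>real n powr (1 + a2) * ln (real n) powr (3 / 2)\<rfloor>))
          (align_event n (\<tau> n) \<beta>)
        \<le> r1 n + r2 n + r3 n + r4 n + exp (- s n)) sequentially"
proof -
  have rate: "align_rate K a1 a2 b1 b2 \<in> O(\<lambda>n. real n powr ((a2 - 1) / 2))"
    by (rule align_rate_bigo[OF K b(1,2) a])
  have size_1': "eventually (\<lambda>n. b1 * real n powr a1 - 1 \<le> bsize n (\<tau> n) 1
      \<and> bsize n (\<tau> n) 1 \<le> b1 * real n powr a1 + 1) sequentially"
    using size_1 by eventually_elim (use rounds_bounds in blast)
  have "filterlim (\<lambda>n. b1 * real n powr a1 - 1) at_top sequentially"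
    using b a by real_asymp
  then have n1_lim: "filterlim (\<lambda>n. real (bsize n (\<tau> n) 1)) at_top sequentially"
    by (rule filterlim_at_top_mono) (use size_1' in eventually_elim, simp)
  \<comment> \<open>The condition \<open>\<beta> < 1\<close> enters here: for large \<open>n\<close>
    the event allows at most half of \<open>B 1\<close> to be shuffled.\<close>
  have "eventually (\<lambda>x::real. x powr \<beta> \<le> x / 2) at_top" using \<beta> by real_asymp
  then have n1_\<beta>: "eventually (\<lambda>n. real (bsize n (\<tau> n) 1) powr \<beta> \<le> real (bsize n (\<tau> n) 1) / 2) sequentially"
    by (rule eventually_compose_filterlim[OF _ n1_lim])
  have n1_6: "eventually (\<lambda>n. 6 \<le> real (bsize n (\<tau> n) 1)) sequentially"
    using n1_lim unfolding filterlim_at_top by blast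
  have "eventually (\<lambda>n. measure_pmf.prob
          (walk_graphs n K (\<Lambda> n) (\<tau> n) q1 q2 (\<mu> n) (nat \<lfloor>real n powr (1 + a2) * ln (real n) powr (3 / 2)\<rfloor>))
          (align_event n (\<tau> n) \<beta>) \<le> align_rate K a1 a2 b1 b2 n) sequentially"
    using size_1' size_max n1_\<beta> n1_6 eventually_gt_at_top[of 0]
  proof eventually_elim
    case (elim n)
    have six: "6 \<le> bsize n (\<tau> n) 1" using elim(4) by simp
    \<comment> \<open>Community 1 is the smallest, so its size bound makes every block nonempty, as
      the locale demands.\<close>
    have ge: "bsize n (\<tau> n) 1 \<le> bsize n (\<tau> n) i" if "i \<in> {1..K}" for i
      unfolding smallest[of n] using that by (intro Min_le) auto
    interpret edgelighter n K "\<tau> n" q1 q2 q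
    proof
      show "block n (\<tau> n) i \<noteq> {}" if "i \<in> {1..K}" for i
      proof
        assume "block n (\<tau> n) i = {}"
        then show False using ge[OF that] six by (simp add: bsize_def)
      qed
    qed (use K labels rates q in auto)
    have max: "real (bsize n (\<tau> n) j) \<le> b2 * real n + 1" if "j \<in> {1..K}" for j
    proof -
      have "bsize n (\<tau> n) j \<le> Max (bsize n (\<tau> n) ` {1..K})" using that by (intro Max_ge) auto
      then show ?thesis using rounds_bounds[OF elim(2)] by linarith
    qed
    show ?case
      using elim six max start[of n] unfolding bsize_def
      by (intro align_prob_le_rate refl) auto
  qed
  then have "eventually (\<lambda>n. measure_pmf.prob
          (walk_graphs n K (\<Lambda> n) (\<tau> n) q1 q2 (\<mu> n) (nat \<lfloor>real n powr (1 + a2) * ln (real n) powr (3 / 2)\<rfloor>))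
          (align_event n (\<tau> n) \<beta>)
        \<le> 0 + 0 + 0 + align_rate K a1 a2 b1 b2 n + exp (- (real n powr a1 * ln (real n) powr (1 / 2)))) sequentially"
  proof eventually_elim
    case (elim n)
    then show ?case
      using exp_ge_zero[of "- (real n powr a1 * ln (real n) powr (1 / 2))"] by linarith
  qed
  moreover have "\<forall>n. real n powr a1 * ln (real n) powr (1 / 2) \<ge> 0" by simp
  ultimately have s: "(\<forall>n. real n powr a1 * ln (real n) powr (1 / 2) \<ge> 0) \<and>
      eventually (\<lambda>n. measure_pmf.prob
          (walk_graphs n K (\<Lambda> n) (\<tau> n) q1 q2 (\<mu> n) (nat \<lfloor>real n powr (1 + a2) * ln (real n) powr (3 / 2)\<rfloor>))
          (align_event n (\<tau> n) \<beta>)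
        \<le> 0 + 0 + 0 + align_rate K a1 a2 b1 b2 n + exp (- (real n powr a1 * ln (real n) powr (1 / 2)))) sequentially"
    by (rule conjI[rotated])
  have zero: "(\<lambda>_. 0) \<in> O(g)" for g :: "nat \<Rightarrow> real" by simp
  show ?thesis
    \<comment> \<open>The witnesses are \<open>C = 1\<close>, zero for the first three summands,
      \<open>align_rate\<close> for the fourth, and for \<open>s\<close> the comparison function
      itself.\<close>
    by (rule exI[of _ 1], rule conjI, simp, rule bexI[OF _ zero], rule bexI[OF _ zero],
        rule bexI[OF _ zero], rule bexI[OF _ rate], rule bexI[OF _ landau_omega.big_refl], rule s)
qed

end
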